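(* Let $E=J^1(T,M)$. (i) If $M^{(i)}_{(\alpha)\beta}$ are the components of a temporal nonlinear connection on $E$, then the components $H^{(i)}_{(\alpha)\beta}=\frac12 M^{(i)}_{(\alpha)\beta}$ represent a temporal spray on $E$. (ii) Conversely, if $H^{(i)}_{(\alpha)\beta}$ are the components of a temporal spray on $E$, then $M^{(i)}_{(\alpha)\beta}=2H^{(i)}_{(\alpha)\beta}$ are the components of a temporal nonlinear connection on $E$.
   Context: $T$ and $M$ are smooth manifolds of dimensions $p$ and $n$; Greek indices run over $1,\dots,p$, Latin indices over $1,\dots,n$; repeated indices are summed. $E=J^1(T,M)$ is the bundle of 1-jets of smooth maps $T\to M$, a vector bundle over $T\times M$. Charts $(t^\alpha)$ of $T$ and $(x^i)$ of $M$ induce a chart $(t^\alpha,x^i,x^i_\alpha)$ of $E$, where $x^i_\alpha$ of the 1-jet of $f$ at $t_0$ is $\frac{\partial (x^i\circ f)}{\partial t^\alpha}(t_0)$. Changes of induced charts have the form $\tilde t^\alpha=\tilde t^\alpha(t^\beta)$, $\tilde x^i=\tilde x^i(x^j)$, $\tilde x^i_\alpha=\frac{\partial\tilde x^i}{\partial x^j}\frac{\partial t^\beta}{\partial\tilde t^\alpha}x^j_\beta$, with invertible Jacobians. In $\frac{\partial\tilde x^k_\mu}{\partial t^\alpha}$ the function $\tilde x^k_\mu$ is regarded as a function of $(t,x,x^j_\beta)$. All local functions are smooth functions on the domains of induced charts of $E$, and tilded quantities refer to a second induced chart. A temporal spray on $E$ is a globally defined (1,1)-tensor field on $E$ that in every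 induced chart has the form $H=dt^\alpha\otimes\frac{\partial}{\partial t^\alpha}-2H^{(j)}_{(\beta)\alpha}\,dt^\alpha\otimes\frac{\partial}{\partial x^j_\beta}$; the local functions $H^{(j)}_{(\beta)\alpha}$ are its components. A temporal nonlinear connection on $E$ is the family of coefficients $M^{(j)}_{(\beta)\alpha}$ of a nonlinear connection, i.e. a family of local functions on induced charts, transforming under changes of induced charts by $$\tilde M^{(j)}_{(\beta)\mu}\frac{\partial\tilde t^\mu}{\partial t^\alpha}=M^{(k)}_{(\gamma)\alpha}\frac{\partial\tilde x^j}{\partial x^k}\frac{\partial t^\gamma}{\partial\tilde t^\beta}-\frac{\partial\tilde x^j_\beta}{\partial t^\alpha}.$$ *)

theory Defs
  imports "HOL-Analysis.Analysis"
begin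

section \<open>Smooth functions and smooth manifolds\<close>

text \<open>Only used for open \<open>S\<close>: \<open>k\<close>-fold continuous differentiability, by recursion on the
  directional derivatives.\<close>

primrec k_times_diff_on :: "nat \<Rightarrow> 'a::euclidean_space set \<Rightarrow> ('a \<Rightarrow> 'b::real_normed_vector) \<Rightarrow> bool"
  where
    "k_times_diff_on 0 S f \<longleftrightarrow> continuous_on S f"
  | "k_times_diff_on (Suc k) S f \<longleftrightarrow>
       (\<forall>x\<in>S. f differentiable (at x)) \<and>
       (\<forall>v. k_times_diff_on k S (\<lambda>x. frechet_derivative f (at x) v))"

definition smooth_on :: "'a::euclidean_space set \<Rightarrow> ('a \<Rightarrow> 'b::real_normed_vector) \<Rightarrow> bool"
  where "smooth_on S f \<longleftrightarrow> (\<forall>k. k_times_diff_on k S f)"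

text \<open>A chart is its domain together with its coordinate map; the values of the map outside the
  domain carry no meaning.\<close>

type_synonym ('a, 'e) chart = "'a set \<times> ('a \<Rightarrow> 'e)"

abbreviation dom_of :: "('a, 'e) chart \<Rightarrow> 'a set"
  where "dom_of c \<equiv> fst c"

abbreviation coord :: "('a, 'e) chart \<Rightarrow> 'a \<Rightarrow> 'e"
  where "coord c \<equiv> snd c"

definition param :: "('a, 'e) chart \<Rightarrow> 'e \<Rightarrow> 'a"
  where "param c = inv_into (dom_of c) (coord c)"

definition transition :: "('a, 'e) chart \<Rightarrow> ('a, 'e) chart \<Rightarrow> 'e \<Rightarrow> 'e"
  where "transition c d = coord d \<circ> param c"

definition topological_chart :: "'a topology \<Rightarrow> ('a, 'e::euclidean_space) chart \<Rightarrow> bool"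
  where "topological_chart X c \<longleftrightarrow>
    openin X (dom_of c) \<and> open (coord c ` dom_of c) \<and>
    homeomorphic_map (subtopology X (dom_of c)) (top_of_set (coord c ` dom_of c)) (coord c)"

definition compatible :: "('a, 'e::euclidean_space) chart \<Rightarrow> ('a, 'e) chart \<Rightarrow> bool"
  where "compatible c d \<longleftrightarrow>
    smooth_on (coord c ` (dom_of c \<inter> dom_of d)) (transition c d) \<and>
    smooth_on (coord d ` (dom_of c \<inter> dom_of d)) (transition d c)"

record ('a, 'e) manifold =
  mtop :: "'a topology"
  charts :: "('a, 'e) chart set"

definition smooth_manifold :: "('a, 'e::euclidean_space) manifold \<Rightarrow> bool"
  where "smooth_manifold X \<longleftrightarrow>
    Hausdorff_space (mtop X) \<and> second_countable (mtop X) \<and>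
    (\<forall>c\<in>charts X. topological_chart (mtop X) c) \<and>
    topspace (mtop X) = (\<Union>c\<in>charts X. dom_of c) \<and>
    (\<forall>c\<in>charts X. \<forall>d\<in>charts X. compatible c d) \<and>
    (\<forall>c. topological_chart (mtop X) c \<and> (\<forall>d\<in>charts X. compatible c d) \<longrightarrow> c \<in> charts X)"

definition smooth_in_chart ::
    "('a, 'e::euclidean_space) chart \<Rightarrow> ('a \<Rightarrow> 'b::real_normed_vector) \<Rightarrow> bool"
  where "smooth_in_chart c f \<longleftrightarrow> smooth_on (coord c ` dom_of c) (f \<circ> param c)"


section \<open>Tangent vectors and (1,1)-tensor fields\<close>

text \<open>A tangent vector at \<open>x\<close> is the family of its component vectors in all charts around \<open>x\<close>;
  the components in two charts are related by the derivative of the change of coordinates.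
  Entries at irrelevant charts are set to \<open>0\<close>, so that the vector is determined by its
  components.\<close>

type_synonym ('a, 'e) tangent = "('a, 'e) chart \<Rightarrow> 'e"

definition tangent_space :: "('a, 'e::euclidean_space) chart set \<Rightarrow> 'a \<Rightarrow> ('a, 'e) tangent set"
  where "tangent_space A x =
    {v. (\<forall>c\<in>A. \<forall>d\<in>A. x \<in> dom_of c \<and> x \<in> dom_of d \<longrightarrow>
           v d = frechet_derivative (transition c d) (at (coord c x)) (v c)) \<and>
        (\<forall>c. \<not> (c \<in> A \<and> x \<in> dom_of c) \<longrightarrow> v c = 0)}"

text \<open>The tangent vector at \<open>x\<close> with components \<open>b\<close> in the chart \<open>c\<close>; for \<open>b\<close> in the standard
  basis these are the coordinate vector fields of \<open>c\<close>.\<close>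

definition coord_vector :: "('a, 'e::euclidean_space) chart set \<Rightarrow> ('a, 'e) chart \<Rightarrow> 'e \<Rightarrow>
    'a \<Rightarrow> ('a, 'e) tangent"
  where "coord_vector A c b x =
    (\<lambda>d. if d \<in> A \<and> x \<in> dom_of d
         then frechet_derivative (transition c d) (at (coord c x)) b else 0)"

text \<open>A (1,1)-tensor field as a smooth field of endomorphisms of the tangent spaces, where
  \<open>\<omega> \<otimes> X\<close> is the endomorphism \<open>v \<mapsto> \<omega>(v) X\<close>.\<close>

definition tensor_field_1_1 :: "('a, 'e::euclidean_space) chart set \<Rightarrow>
    ('a \<Rightarrow> ('a, 'e) tangent \<Rightarrow> ('a, 'e) tangent) \<Rightarrow> bool"
  where "tensor_field_1_1 A K \<longleftrightarrow>
    (\<forall>x\<in>(\<Union>c\<in>A. dom_of c).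
       (\<forall>v\<in>tangent_space A x. K x v \<in> tangent_space A x) \<and>
       (\<forall>u\<in>tangent_space A x. \<forall>v\<in>tangent_space A x. \<forall>a b.
          K x (\<lambda>c. a *\<^sub>R u c + b *\<^sub>R v c) = (\<lambda>c. a *\<^sub>R K x u c + b *\<^sub>R K x v c))) \<and>
    (\<forall>c\<in>A. \<forall>b\<in>Basis. smooth_in_chart c (\<lambda>x. K x (coord_vector A c b x) c))"


section \<open>The jet bundle \<open>J\<^sup>1(T,M)\<close>\<close>

text \<open>As a 1-jet at \<open>t\<close> depends only on the germ at \<open>t\<close>, jets are taken of maps that are smooth
  near \<open>t\<close>, with no condition on the values elsewhere. By a cut-off in a chart, each such jet is
  the jet of a smooth map on all of \<open>T\<close>.\<close>

definition smooth_near :: "('t, real^'p) manifold \<Rightarrow> ('m, real^'n) manifold \<Rightarrow>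
    ('t \<Rightarrow> 'm) \<Rightarrow> 't \<Rightarrow> bool"
  where "smooth_near T M f t \<longleftrightarrow>
    (\<exists>\<phi>\<in>charts T. \<exists>\<psi>\<in>charts M. \<exists>W. openin (mtop T) W \<and> t \<in> W \<and> W \<subseteq> dom_of \<phi> \<and>
       f ` W \<subseteq> dom_of \<psi> \<and> smooth_on (coord \<phi> ` W) (coord \<psi> \<circ> f \<circ> param \<phi>))"

text \<open>The matrix of the \<open>\<partial>(x\<^sup>i \<circ> f)/\<partial>t\<^sup>\<alpha>\<close> at \<open>t\<close>, with row index \<open>i\<close> and column
  index \<open>\<alpha>\<close>.\<close>

definition jet_matrix :: "('t, real^'p) chart \<Rightarrow> ('m, real^'n) chart \<Rightarrow>
    't \<Rightarrow> ('t \<Rightarrow> 'm) \<Rightarrow> real^'p^'n"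
  where "jet_matrix \<phi> \<psi> t f = jacobian (coord \<psi> \<circ> f \<circ> param \<phi>) (at (coord \<phi> t))"

definition jet_reps :: "('t, real^'p) manifold \<Rightarrow> ('m, real^'n) manifold \<Rightarrow> ('t \<times> ('t \<Rightarrow> 'm)) set"
  where "jet_reps T M = {(t, f). t \<in> topspace (mtop T) \<and> smooth_near T M f t}"

definition jet_rel :: "('t, real^'p) manifold \<Rightarrow> ('m, real^'n) manifold \<Rightarrow>
    ('t \<times> ('t \<Rightarrow> 'm)) rel"
  where "jet_rel T M =
    {((s, f), (t, g)). (s, f) \<in> jet_reps T M \<and> (t, g) \<in> jet_reps T M \<and> s = t \<and> f t = g t \<and>
       (\<forall>\<phi>\<in>charts T. \<forall>\<psi>\<in>charts M. t \<in> dom_of \<phi> \<and> f t \<in> dom_of \<psi> \<longrightarrow>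
          jet_matrix \<phi> \<psi> t f = jet_matrix \<phi> \<psi> t g)}"

type_synonym ('t, 'm) jet = "('t \<times> ('t \<Rightarrow> 'm)) set"

definition J1 :: "('t, real^'p) manifold \<Rightarrow> ('m, real^'n) manifold \<Rightarrow> ('t, 'm) jet set"
  where "J1 T M = jet_reps T M // jet_rel T M"

text \<open>Coordinates \<open>(t, x, z)\<close> on \<open>J\<^sup>1(T,M)\<close>, with \<open>z $ i $ \<alpha>\<close> for \<open>x\<^sup>i\<^sub>\<alpha>\<close>.\<close>

type_synonym ('p, 'n) jet_coords = "(real^'p) \<times> (real^'n) \<times> (real^'p^'n)"

definition induced_coord :: "('t, real^'p) chart \<Rightarrow> ('m, real^'n) chart \<Rightarrow>
    ('t, 'm) jet \<Rightarrow> ('p, 'n) jet_coords"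
  where "induced_coord \<phi> \<psi> e =
    the_elem ((\<lambda>(t, f). (coord \<phi> t, coord \<psi> (f t), jet_matrix \<phi> \<psi> t f)) ` e)"

definition induced_chart :: "('t, real^'p) manifold \<Rightarrow> ('m, real^'n) manifold \<Rightarrow>
    ('t, real^'p) chart \<Rightarrow> ('m, real^'n) chart \<Rightarrow> (('t, 'm) jet, ('p, 'n) jet_coords) chart"
  where "induced_chart T M \<phi> \<psi> =
    ({e \<in> J1 T M. \<exists>(t, f)\<in>e. t \<in> dom_of \<phi> \<and> f t \<in> dom_of \<psi>}, induced_coord \<phi> \<psi>)"

definition jet_atlas :: "('t, real^'p) manifold \<Rightarrow> ('m, real^'n) manifold \<Rightarrow>
    (('t, 'm) jet, ('p, 'n) jet_coords) chart set"
  where "jet_atlas T M = {induced_chart T M \<phi> \<psi> |\<phi> \<psi>. \<phi> \<in> charts T \<and> \<psi> \<in> charts M}"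


section \<open>Temporal sprays and temporal nonlinear connections\<close>

text \<open>Families of local functions on induced charts: \<open>H \<phi> \<psi> j \<beta> \<alpha> e\<close> is the value at the jet \<open>e\<close>
  of the local function with upper index \<open>j\<close>, first lower index \<open>\<beta>\<close> (the one in parentheses) and
  second lower index \<open>\<alpha>\<close>, in the chart induced by \<open>\<phi>\<close> and \<open>\<psi>\<close>.\<close>

type_synonym ('t, 'm, 'p, 'n) local_family =
  "('t, real^'p) chart \<Rightarrow> ('m, real^'n) chart \<Rightarrow> 'n \<Rightarrow> 'p \<Rightarrow> 'p \<Rightarrow> ('t, 'm) jet \<Rightarrow> real"

definition smooth_family :: "('t, real^'p) manifold \<Rightarrow> ('m, real^'n) manifold \<Rightarrow>
    ('t, 'm, 'p, 'n) local_family \<Rightarrow> bool"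
  where "smooth_family T M H \<longleftrightarrow>
    (\<forall>\<phi>\<in>charts T. \<forall>\<psi>\<in>charts M. \<forall>j \<beta> \<alpha>.
       smooth_in_chart (induced_chart T M \<phi> \<psi>) (H \<phi> \<psi> j \<beta> \<alpha>))"

text \<open>Components in an induced chart of the coordinate vector fields \<open>\<partial>/\<partial>t\<^sup>\<alpha>\<close> and
  \<open>\<partial>/\<partial>x\<^sup>j\<^sub>\<beta>\<close>.\<close>

definition ddt :: "'p::finite \<Rightarrow> ('p, 'n::finite) jet_coords"
  where "ddt \<alpha> = (axis \<alpha> 1, 0, 0)"

definition ddz :: "'n::finite \<Rightarrow> 'p::finite \<Rightarrow> ('p, 'n) jet_coords"
  where "ddz j \<beta> = (0, 0, axis j (axis \<beta> 1))"

text \<open>\<open>K\<close> is a temporal spray with components \<open>H\<close>. Here \<open>fst (v c) $ \<alpha>\<close> is \<open>dt\<^sup>\<alpha>(v)\<close> in the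
  induced chart \<open>c\<close>.\<close>

definition temporal_spray_with :: "('t, real^'p) manifold \<Rightarrow> ('m, real^'n) manifold \<Rightarrow>
    (('t, 'm) jet \<Rightarrow> (('t, 'm) jet, ('p, 'n) jet_coords) tangent \<Rightarrow>
      (('t, 'm) jet, ('p, 'n) jet_coords) tangent) \<Rightarrow>
    ('t, 'm, 'p, 'n) local_family \<Rightarrow> bool"
  where "temporal_spray_with T M K H \<longleftrightarrow>
    tensor_field_1_1 (jet_atlas T M) K \<and> smooth_family T M H \<and>
    (\<forall>\<phi>\<in>charts T. \<forall>\<psi>\<in>charts M. let c = induced_chart T M \<phi> \<psi> in
       \<forall>e\<in>dom_of c. \<forall>v\<in>tangent_space (jet_atlas T M) e.
         K e v c = (\<Sum>\<alpha>\<in>UNIV. (fst (v c) $ \<alpha>) *\<^sub>R ddt \<alpha>)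
           - 2 *\<^sub>R (\<Sum>j\<in>UNIV. \<Sum>\<beta>\<in>UNIV. \<Sum>\<alpha>\<in>UNIV.
               (H \<phi> \<psi> j \<beta> \<alpha> e * (fst (v c) $ \<alpha>)) *\<^sub>R ddz j \<beta>))"

definition temporal_spray_components :: "('t, real^'p) manifold \<Rightarrow> ('m, real^'n) manifold \<Rightarrow>
    ('t, 'm, 'p, 'n) local_family \<Rightarrow> bool"
  where "temporal_spray_components T M H \<longleftrightarrow> (\<exists>K. temporal_spray_with T M K H)"

text \<open>Below, \<open>\<tau>\<close>, \<open>\<xi>\<close>, \<open>\<sigma>\<close>, \<open>\<Theta>\<close> are the coordinate changes \<open>t \<mapsto> t~\<close>, \<open>x \<mapsto> x~\<close>, \<open>t~ \<mapsto> t\<close> and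
  \<open>(t, x, z) \<mapsto> (t~, x~, z~)\<close>; the last term is \<open>\<partial>x~\<^sup>j\<^sub>\<beta>/\<partial>t\<^sup>\<alpha>\<close>, taken with \<open>x\<close> and \<open>z\<close>
  fixed.\<close>

definition temporal_nonlinear_connection ::
    "('t, real^'p) manifold \<Rightarrow> ('m, real^'n) manifold \<Rightarrow> ('t, 'm, 'p, 'n) local_family \<Rightarrow> bool"
  where "temporal_nonlinear_connection T M N \<longleftrightarrow>
    smooth_family T M N \<and>
    (\<forall>\<phi>\<in>charts T. \<forall>\<psi>\<in>charts M. \<forall>\<phi>'\<in>charts T. \<forall>\<psi>'\<in>charts M.
       let c = induced_chart T M \<phi> \<psi>; c' = induced_chart T M \<phi>' \<psi>';
           \<tau> = transition \<phi> \<phi>'; \<xi> = transition \<psi> \<psi>'; \<sigma> = transition \<phi>' \<phi>; \<Theta> = transition c c'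
       in \<forall>e\<in>dom_of c \<inter> dom_of c'.
         let (t, x, z) = coord c e; (t', x', z') = coord c' e in
         \<forall>j \<beta> \<alpha>.
           (\<Sum>\<mu>\<in>UNIV. N \<phi>' \<psi>' j \<beta> \<mu> e * jacobian \<tau> (at t) $ \<mu> $ \<alpha>) =
           (\<Sum>k\<in>UNIV. \<Sum>\<gamma>\<in>UNIV.
              N \<phi> \<psi> k \<gamma> \<alpha> e * jacobian \<xi> (at x) $ j $ k * jacobian \<sigma> (at t') $ \<gamma> $ \<beta>)
           - snd (snd (frechet_derivative \<Theta> (at (t, x, z)) (ddt \<alpha>))) $ j $ \<beta>)"

end

theory Submission
  imports Defs
begin

text \<open>In an induced chart the tensor \<open>dt\<^sup>\<alpha> \<otimes> \<partial>/\<partial>t\<^sup>\<alpha> - 2 H dt \<otimes> \<partial>/\<partial>z\<close> is the linear map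
  \<open>(a, b, w) \<mapsto> (a, 0, -2 H a)\<close> (\<open>spray_map\<close>). Local expressions of this form glue to a
  (1,1)-tensor field on the jet bundle exactly when, at every jet in two induced charts, the
  derivative \<open>D\<close> of the change of coordinates intertwines the two linear maps. The idea of the
  proof is that this intertwining condition, written out, is the transformation law of a temporal
  nonlinear connection with coefficients \<open>2 H\<close>, so that both implications come from one
  equivalence.

  For the comparison only the shape of \<open>D\<close> matters. The change of induced coordinates is
  \<open>(t, x, z) \<mapsto> (\<tau> t, \<xi> x, \<xi>'(x) z \<sigma>'(\<tau> t))\<close> with \<open>\<sigma> = \<tau>\<^sup>-\<^sup>1\<close>. Hence \<open>D\<close> maps \<open>(a, 0, w)\<close> to
  \<open>(\<tau>' a, 0, X a + \<xi>' w \<sigma>')\<close>, where \<open>X a\<close> is the derivative of the new fibre coordinates in the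
  direction \<open>(a, 0, 0)\<close>. The first two components of the intertwining condition hold automatically
  and the third is \<open>2 H~ (\<tau>' a) = 2 \<xi>' (H a) \<sigma>' - X a\<close>. Both sides are linear in \<open>a\<close>, and for
  \<open>a\<close> in the standard basis this is the transformation law (\<open>spray_map_intertwines_iff\<close>).

  What remains is to justify the calculus. Jets are classes of germs, so it has to be shown that the
  induced coordinates are well defined and injective, that they fill the whole fibre
  (\<open>jet_exists\<close>), that the overlap of two induced charts has open image
  (\<open>induced_coord_image_overlap\<close>), and that the change of coordinates has the stated form and is
  differentiable (\<open>jet_matrix_change\<close>, \<open>jet_coord_change_has_derivative\<close>). The chain rule then gives
  a tangent vector for prescribed components in one chart
  (\<open>coord_vector_in_tangent_space\<close>), which is what the passage between the tensor field and
  its local expressions uses in both directions.\<close>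

section \<open>Calculus of smooth functions\<close>

text \<open>Openness lets the derivatives of \<open>f\<close> and \<open>g\<close> agree on \<open>S\<close> as well, so the induction applies
  to them.\<close>

lemma k_times_diff_on_cong:
  assumes "open S" and "\<And>x. x \<in> S \<Longrightarrow> f x = g x" and "k_times_diff_on k S f"
  shows "k_times_diff_on k S g"
  using assms(2,3)
proof (induction k arbitrary: f g)
  case 0
  then show ?case using continuous_on_cong[OF refl, of S f g] by simp
next
  case (Suc k)
  have der: "(g has_derivative frechet_derivative f (at x)) (at x)" if "x \<in> S" for x
  proof (rule has_derivative_transform_within_open[OF _ \<open>open S\<close> that Suc.prems(1)])
    show "(f has_derivative frechet_derivative f (at x)) (at x)"
      using Suc.prems(2) that frechet_derivative_works by auto
  qed
  have eq: "frechet_derivative f (at x) = frechet_derivative g (at x)" if "x \<in> S" for x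
    by (rule frechet_derivative_at[OF der[OF that]])
  have "k_times_diff_on k S (\<lambda>x. frechet_derivative g (at x) v)" for v
    by (rule Suc.IH[of "\<lambda>x. frechet_derivative f (at x) v"]) (use Suc.prems(2) eq in auto)
  then show ?case
    using der by (auto simp: differentiable_def)
qed

lemma smooth_on_cong:
  assumes "open S" and "\<And>x. x \<in> S \<Longrightarrow> f x = g x" and "smooth_on S f"
  shows "smooth_on S g"
  using assms(3) k_times_diff_on_cong[OF assms(1,2)] by (simp add: smooth_on_def)

lemma smooth_on_const: "smooth_on S (\<lambda>x. c)"
proof -
  have "k_times_diff_on k S (\<lambda>x. c)" for k
    by (induction k arbitrary: c) simp_all
  then show ?thesis by (simp add: smooth_on_def)
qed

lemma k_times_diff_on_linear_compose:
  assumes "open S" and "bounded_linear h" and "k_times_diff_on k S f"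
  shows "k_times_diff_on k S (\<lambda>x. h (f x))"
  using assms(3)
proof (induction k arbitrary: f)
  case 0
  then show ?case
    using assms(2) by (simp add: bounded_linear.continuous_on)
next
  case (Suc k)
  have der: "((\<lambda>x. h (f x)) has_derivative (\<lambda>v. h (frechet_derivative f (at x) v))) (at x)"
    if "x \<in> S" for x
    using Suc.prems that frechet_derivative_works
    by (intro bounded_linear.has_derivative[OF assms(2)]) auto
  have eq: "frechet_derivative (\<lambda>x. h (f x)) (at x) = (\<lambda>v. h (frechet_derivative f (at x) v))"
    if "x \<in> S" for x
    by (rule frechet_derivative_at[OF der[OF that], symmetric])
  have "k_times_diff_on k S (\<lambda>x. frechet_derivative (\<lambda>x. h (f x)) (at x) v)" for v
    by (rule k_times_diff_on_cong[OF assms(1), of "\<lambda>x. h (frechet_derivative f (at x) v)"])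
      (use Suc eq in auto)
  then show ?case
    using der by (auto simp: differentiable_def)
qed

lemma smooth_on_linear_compose:
  assumes "open S" and "bounded_linear h" and "smooth_on S f"
  shows "smooth_on S (\<lambda>x. h (f x))"
  using assms(3) k_times_diff_on_linear_compose[OF assms(1,2)] by (simp add: smooth_on_def)

lemma k_times_diff_on_add:
  assumes "open S" and "k_times_diff_on k S f" and "k_times_diff_on k S g"
  shows "k_times_diff_on k S (\<lambda>x. f x + g x)"
  using assms(2,3)
proof (induction k arbitrary: f g)
  case 0
  then show ?case by (simp add: continuous_on_add)
next
  case (Suc k)
  have der: "((\<lambda>x. f x + g x) has_derivative
      (\<lambda>v. frechet_derivative f (at x) v + frechet_derivative g (at x) v)) (at x)"
    if "x \<in> S" for x
    using Suc.prems that frechet_derivative_works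
    by (intro has_derivative_add) auto
  have eq: "frechet_derivative (\<lambda>x. f x + g x) (at x) =
      (\<lambda>v. frechet_derivative f (at x) v + frechet_derivative g (at x) v)"
    if "x \<in> S" for x
    by (rule frechet_derivative_at[OF der[OF that], symmetric])
  have "k_times_diff_on k S (\<lambda>x. frechet_derivative (\<lambda>x. f x + g x) (at x) v)" for v
    by (rule k_times_diff_on_cong[OF assms(1),
          of "\<lambda>x. frechet_derivative f (at x) v + frechet_derivative g (at x) v"])
      (use Suc eq in auto)
  then show ?case
    using der by (auto simp: differentiable_def)
qed

lemma smooth_on_add:
  assumes "open S" and "smooth_on S f" and "smooth_on S g"
  shows "smooth_on S (\<lambda>x. f x + g x)"
  using assms(2,3) unfolding smooth_on_def by (blast intro: k_times_diff_on_add[OF assms(1)])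

lemma smooth_on_sum:
  assumes "open S" and "\<And>i. i \<in> I \<Longrightarrow> smooth_on S (f i)"
  shows "smooth_on S (\<lambda>x. \<Sum>i\<in>I. f i x)"
  using assms(2)
  by (induction I rule: infinite_finite_induct)
    (auto intro: smooth_on_const smooth_on_add[OF assms(1)])

lemma smooth_on_linear:
  assumes "bounded_linear h"
  shows "smooth_on S h"
  unfolding smooth_on_def
proof
  fix k
  show "k_times_diff_on k S h"
  proof (cases k)
    case 0
    then show ?thesis using assms by (simp add: linear_continuous_on)
  next
    case (Suc l)
    have "frechet_derivative h (at x) = h" for x
      using bounded_linear_imp_has_derivative[OF assms] frechet_derivative_at by metis
    then show ?thesis
      using smooth_on_const[of S] bounded_linear_imp_differentiable[OF assms] Suc
      by (auto simp: smooth_on_def)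
  qed
qed

lemma smooth_on_imp_differentiable: "smooth_on S f \<Longrightarrow> x \<in> S \<Longrightarrow> f differentiable (at x)"
  using k_times_diff_on.simps(2)[of 0 S f] by (auto simp: smooth_on_def)

lemma smooth_on_frechet_derivative:
  "smooth_on S f \<Longrightarrow> smooth_on S (\<lambda>x. frechet_derivative f (at x) v)"
  unfolding smooth_on_def
proof
  fix k assume "\<forall>k. k_times_diff_on k S f"
  then have "k_times_diff_on (Suc k) S f" ..
  then show "k_times_diff_on k S (\<lambda>x. frechet_derivative f (at x) v)" by simp
qed

lemma bounded_bilinear_matrix_matrix_mult:
  "bounded_bilinear ((**) :: real^'b^'a \<Rightarrow> real^'c^'b \<Rightarrow> real^'c^'a)"
proof -
  have "bilinear ((**) :: real^'b^'a \<Rightarrow> real^'c^'b \<Rightarrow> real^'c^'a)"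
    unfolding bilinear_def
    by (auto intro!: linearI simp: matrix_matrix_mult_def vec_eq_iff sum.distrib sum_distrib_left
        algebra_simps)
  then show ?thesis by (simp add: bilinear_conv_bounded_bilinear)
qed

text \<open>The Jacobian is the sum of its columns, each a linear image of a directional derivative, and
  directional derivatives of smooth functions are smooth.\<close>

lemma differentiable_jacobian:
  fixes f :: "real^'a \<Rightarrow> real^'b"
  assumes "smooth_on S f" and "x \<in> S"
  shows "(\<lambda>x. jacobian f (at x)) differentiable (at x)"
proof -
  define col :: "'a \<Rightarrow> real^'b \<Rightarrow> real^'a^'b" where "col j v = (\<chi> i k. if k = j then v $ i else 0)" for j v
  have "linear (col j)" for j
    by (auto intro!: linearI simp: col_def vec_eq_iff)
  then have "bounded_linear (col j)" for j
    by (rule linear_conv_bounded_linear[THEN iffD1])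
  then have "(\<lambda>x. col j (frechet_derivative f (at x) (axis j 1))) differentiable (at x)" for j
    using smooth_on_imp_differentiable[OF smooth_on_frechet_derivative[OF assms(1)] assms(2)]
      bounded_linear.has_derivative unfolding differentiable_def by blast
  then have "(\<lambda>x. \<Sum>j\<in>UNIV. col j (frechet_derivative f (at x) (axis j 1))) differentiable (at x)"
    by (intro differentiable_sum) auto
  moreover have "jacobian f (at x) = (\<Sum>j\<in>UNIV. col j (frechet_derivative f (at x) (axis j 1)))" for x
    by (simp add: jacobian_def matrix_def col_def vec_eq_iff)
  ultimately show ?thesis by simp
qed

section \<open>Differentiable atlases and their tangent vectors\<close>

text \<open>The manifolds \<open>T\<close> and \<open>M\<close> and the jet bundle all enter the argument through the chain rule
  for changes of charts. These are the properties of a set of charts on which it rests.\<close>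

locale differentiable_atlas =
  fixes A :: "('a, 'e::euclidean_space) chart set"
  assumes inj_coord: "c \<in> A \<Longrightarrow> inj_on (coord c) (dom_of c)"
    and open_overlap: "c \<in> A \<Longrightarrow> d \<in> A \<Longrightarrow> open (coord c ` (dom_of c \<inter> dom_of d))"
    and transition_differentiable: "c \<in> A \<Longrightarrow> d \<in> A \<Longrightarrow> x \<in> dom_of c \<Longrightarrow> x \<in> dom_of d \<Longrightarrow>
      transition c d differentiable (at (coord c x))"
begin

lemma param_coord: "c \<in> A \<Longrightarrow> x \<in> dom_of c \<Longrightarrow> param c (coord c x) = x"
  by (simp add: param_def inj_coord)

lemma transition_coord: "c \<in> A \<Longrightarrow> x \<in> dom_of c \<Longrightarrow> transition c d (coord c x) = coord d x"
  by (simp add: transition_def param_coord)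

lemma open_image: "c \<in> A \<Longrightarrow> open (coord c ` dom_of c)"
  using open_overlap[of c c] by simp

definition Dtrans :: "('a, 'e) chart \<Rightarrow> ('a, 'e) chart \<Rightarrow> 'a \<Rightarrow> 'e \<Rightarrow> 'e"
  where "Dtrans c d x = frechet_derivative (transition c d) (at (coord c x))"

lemma has_derivative_transition:
  "c \<in> A \<Longrightarrow> d \<in> A \<Longrightarrow> x \<in> dom_of c \<Longrightarrow> x \<in> dom_of d \<Longrightarrow>
    (transition c d has_derivative Dtrans c d x) (at (coord c x))"
  using transition_differentiable by (simp add: Dtrans_def frechet_derivative_works)

lemma linear_Dtrans:
  "c \<in> A \<Longrightarrow> d \<in> A \<Longrightarrow> x \<in> dom_of c \<Longrightarrow> x \<in> dom_of d \<Longrightarrow> linear (Dtrans c d x)"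
  using has_derivative_transition has_derivative_linear by blast

text \<open>A change of coordinates may be differentiated through any formula \<open>f\<close> that represents it near
  the point: the set of relevant coordinates is a neighbourhood because overlaps have open images.\<close>

lemma Dtrans_eqI:
  assumes "c \<in> A" "d \<in> A" "x \<in> dom_of c" "x \<in> dom_of d"
    and "(f has_derivative D) (at (coord c x))"
    and "open U" and "coord c x \<in> U"
    and "\<And>y. y \<in> dom_of c \<Longrightarrow> y \<in> dom_of d \<Longrightarrow> coord c y \<in> U \<Longrightarrow> f (coord c y) = coord d y"
  shows "Dtrans c d x = D"
proof -
  have "(transition c d has_derivative D) (at (coord c x))"
  proof (rule has_derivative_transform_within_open[OF assms(5)])
    show "open (U \<inter> coord c ` (dom_of c \<inter> dom_of d))"
      using assms open_overlap by blast
  qed (use assms in \<open>auto simp: transition_coord\<close>)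
  then show ?thesis
    unfolding Dtrans_def using frechet_derivative_at by metis
qed

lemma Dtrans_self: "c \<in> A \<Longrightarrow> x \<in> dom_of c \<Longrightarrow> Dtrans c c x = (\<lambda>b. b)"
  by (rule Dtrans_eqI[where f = "\<lambda>y. y" and U = UNIV]) auto

lemma Dtrans_comp:
  assumes "c \<in> A" "d \<in> A" "e \<in> A" "x \<in> dom_of c" "x \<in> dom_of d" "x \<in> dom_of e"
  shows "Dtrans d e x (Dtrans c d x b) = Dtrans c e x b"
proof -
  have "((\<lambda>y. transition d e (transition c d y)) has_derivative
      (\<lambda>b. Dtrans d e x (Dtrans c d x b))) (at (coord c x))"
    using has_derivative_compose[OF has_derivative_transition[of c d x],
        of "transition d e" "Dtrans d e x"] has_derivative_transition[of d e x] assms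
    by (simp add: transition_coord)
  then have "Dtrans c e x = (\<lambda>b. Dtrans d e x (Dtrans c d x b))"
    using assms inj_coord[of c] open_overlap[of c d]
    by (intro Dtrans_eqI[where U = "coord c ` (dom_of c \<inter> dom_of d)"])
      (auto simp: transition_coord inj_on_def)
  then show ?thesis by simp
qed

lemma tangent_space_iff: "v \<in> tangent_space A x \<longleftrightarrow>
    (\<forall>c\<in>A. \<forall>d\<in>A. x \<in> dom_of c \<and> x \<in> dom_of d \<longrightarrow> v d = Dtrans c d x (v c)) \<and>
    (\<forall>c. \<not> (c \<in> A \<and> x \<in> dom_of c) \<longrightarrow> v c = 0)"
  by (simp add: tangent_space_def Dtrans_def)

lemma Dtrans_tangent:
  "v \<in> tangent_space A x \<Longrightarrow> c \<in> A \<Longrightarrow> d \<in> A \<Longrightarrow> x \<in> dom_of c \<Longrightarrow> x \<in> dom_of d \<Longrightarrow>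
    Dtrans c d x (v c) = v d"
  unfolding tangent_space_iff by metis

lemma coord_vector_eq: "d \<in> A \<Longrightarrow> x \<in> dom_of d \<Longrightarrow> coord_vector A c b x d = Dtrans c d x b"
  by (simp add: coord_vector_def Dtrans_def)

lemma coord_vector_self: "c \<in> A \<Longrightarrow> x \<in> dom_of c \<Longrightarrow> coord_vector A c b x c = b"
  by (simp add: coord_vector_eq Dtrans_self)

text \<open>By the chain rule, components prescribed in one chart determine a consistent family of
  components. So every vector occurs as the components of a tangent vector, and an endomorphism of
  the tangent space can be defined from its expression in a single chart.\<close>

lemma coord_vector_in_tangent_space:
  assumes "c \<in> A" "x \<in> dom_of c"
  shows "coord_vector A c b x \<in> tangent_space A x"
  unfolding tangent_space_iff
  using assms Dtrans_comp by (auto simp: coord_vector_eq) (auto simp: coord_vector_def)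

lemma coord_vector_linear:
  assumes "c \<in> A" "x \<in> dom_of c"
  shows "coord_vector A c (a *\<^sub>R u + b *\<^sub>R v) x =
    (\<lambda>d. a *\<^sub>R coord_vector A c u x d + b *\<^sub>R coord_vector A c v x d)"
proof
  fix d
  show "coord_vector A c (a *\<^sub>R u + b *\<^sub>R v) x d =
      a *\<^sub>R coord_vector A c u x d + b *\<^sub>R coord_vector A c v x d"
  proof (cases "d \<in> A \<and> x \<in> dom_of d")
    case True
    then show ?thesis
      using assms linear_Dtrans[of c d x] by (simp add: coord_vector_eq linear_add linear_scale)
  qed (auto simp: coord_vector_def)
qed

end

lemma smooth_manifold_charts:
  assumes "smooth_manifold X" and "c \<in> charts X"
  shows "openin (mtop X) (dom_of c)"
    and "homeomorphic_map (subtopology (mtop X) (dom_of c)) (top_of_set (coord c ` dom_of c)) (coord c)"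
    and "open (coord c ` dom_of c)" and "dom_of c \<subseteq> topspace (mtop X)"
  using assms openin_subset by (fastforce simp: smooth_manifold_def topological_chart_def)+

lemma smooth_manifold_inj_coord:
  assumes "smooth_manifold X" and "c \<in> charts X"
  shows "inj_on (coord c) (dom_of c)"
  using homeomorphic_imp_injective_map[OF smooth_manifold_charts(2)[OF assms]]
    smooth_manifold_charts(4)[OF assms]
  by (simp add: topspace_subtopology inf_absorb2)

lemma smooth_manifold_open_overlap:
  assumes "smooth_manifold X" and "c \<in> charts X" and "d \<in> charts X"
  shows "open (coord c ` (dom_of c \<inter> dom_of d))"
proof -
  have "openin (subtopology (mtop X) (dom_of c)) (dom_of c \<inter> dom_of d)"
    using smooth_manifold_charts(1)[OF assms(1,3)] openin_subtopology_Int2 by blast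
  then have "openin (top_of_set (coord c ` dom_of c)) (coord c ` (dom_of c \<inter> dom_of d))"
    using homeomorphic_imp_open_map[OF smooth_manifold_charts(2)[OF assms(1,2)]]
    by (simp add: open_map_def)
  then show ?thesis
    using smooth_manifold_charts(3)[OF assms(1,2)] openin_open_trans by blast
qed

lemma smooth_on_transition:
  assumes "smooth_manifold X" and "c \<in> charts X" and "d \<in> charts X"
  shows "smooth_on (coord c ` (dom_of c \<inter> dom_of d)) (transition c d)"
  using assms by (auto simp: smooth_manifold_def compatible_def)

lemma differentiable_atlas_charts:
  assumes "smooth_manifold X"
  shows "differentiable_atlas (charts X)"
proof
  fix c d x assume "c \<in> charts X" "d \<in> charts X" "x \<in> dom_of c" "x \<in> dom_of d"
  then show "transition c d differentiable (at (coord c x))"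
    by (intro smooth_on_imp_differentiable[OF smooth_on_transition[OF assms]]) auto
qed (use assms smooth_manifold_inj_coord smooth_manifold_open_overlap in auto)

section \<open>Jets and their coordinates\<close>

locale two_manifolds =
  fixes T :: "('t, real^'p) manifold" and M :: "('m, real^'n) manifold"
  assumes smooth_T: "smooth_manifold T" and smooth_M: "smooth_manifold M"
begin

sublocale T: differentiable_atlas "charts T"
  by (rule differentiable_atlas_charts[OF smooth_T])

sublocale M: differentiable_atlas "charts M"
  by (rule differentiable_atlas_charts[OF smooth_M])

text \<open>The eventuality keeps \<open>f\<close> near \<open>t\<close> inside the domain of \<open>\<psi>\<close>, where \<open>coord \<psi>\<close> is meaningful;
  differentiability of the composite at a single point would not ensure this.\<close>

definition has_jet_derivative ::
    "('t, real^'p) chart \<Rightarrow> ('m, real^'n) chart \<Rightarrow> 't \<Rightarrow> ('t \<Rightarrow> 'm) \<Rightarrow> (real^'p \<Rightarrow> real^'n) \<Rightarrow> bool"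
  where "has_jet_derivative \<phi> \<psi> t f D \<longleftrightarrow>
    t \<in> dom_of \<phi> \<and> f t \<in> dom_of \<psi> \<and>
    (\<forall>\<^sub>F s in nhds (coord \<phi> t). f (param \<phi> s) \<in> dom_of \<psi>) \<and>
    ((coord \<psi> \<circ> f \<circ> param \<phi>) has_derivative D) (at (coord \<phi> t))"

text \<open>Near \<open>t\<close> the new coordinate expression of \<open>f\<close> is \<open>\<xi> \<circ> F \<circ> \<sigma>\<close> with \<open>F\<close> the old one, so the
  derivative follows from the chain rule. The work lies in showing that this representation holds in
  a whole neighbourhood, which uses the continuity of \<open>F \<circ> \<sigma>\<close> and the injectivity of \<open>coord \<psi>\<close>.\<close>

lemma has_jet_derivative_change:
  assumes charts: "\<phi> \<in> charts T" "\<psi> \<in> charts M" "\<phi>' \<in> charts T" "\<psi>' \<in> charts M"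
    and dom: "t \<in> dom_of \<phi>'" "f t \<in> dom_of \<psi>'"
    and jet: "has_jet_derivative \<phi> \<psi> t f D"
  shows "has_jet_derivative \<phi>' \<psi>' t f
    (\<lambda>v. M.Dtrans \<psi> \<psi>' (f t) (D (T.Dtrans \<phi>' \<phi> t v)))"
proof -
  define F where "F = coord \<psi> \<circ> f \<circ> param \<phi>"
  define \<sigma> where "\<sigma> = transition \<phi>' \<phi>"
  define U where "U = coord \<phi>' ` (dom_of \<phi>' \<inter> dom_of \<phi>)"
  define V where "V = coord \<psi> ` (dom_of \<psi> \<inter> dom_of \<psi>')"
  have jet': "t \<in> dom_of \<phi>" "f t \<in> dom_of \<psi>"
      "\<forall>\<^sub>F s in nhds (coord \<phi> t). f (param \<phi> s) \<in> dom_of \<psi>"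
      "(F has_derivative D) (at (coord \<phi> t))"
    using jet by (auto simp: has_jet_derivative_def F_def)
  have \<sigma>t: "\<sigma> (coord \<phi>' t) = coord \<phi> t"
    using charts dom by (simp add: \<sigma>_def T.transition_coord)
  have Ft: "F (coord \<phi> t) = coord \<psi> (f t)"
    using charts jet' by (simp add: F_def T.param_coord)
  have \<sigma>': "(\<sigma> has_derivative T.Dtrans \<phi>' \<phi> t) (at (coord \<phi>' t))"
    unfolding \<sigma>_def using charts dom jet' by (intro T.has_derivative_transition)
  have F\<sigma>': "((\<lambda>s. F (\<sigma> s)) has_derivative (\<lambda>v. D (T.Dtrans \<phi>' \<phi> t v))) (at (coord \<phi>' t))"
    using has_derivative_compose[OF \<sigma>', of F D] jet' \<sigma>t by simp
  have \<xi>F\<sigma>': "((\<lambda>s. transition \<psi> \<psi>' (F (\<sigma> s))) has_derivative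
      (\<lambda>v. M.Dtrans \<psi> \<psi>' (f t) (D (T.Dtrans \<phi>' \<phi> t v)))) (at (coord \<phi>' t))"
    using has_derivative_compose[OF F\<sigma>', of "transition \<psi> \<psi>'" "M.Dtrans \<psi> \<psi>' (f t)"]
      M.has_derivative_transition[of \<psi> \<psi>' "f t"] charts dom jet' \<sigma>t Ft by simp
  have lim: "(\<sigma> \<longlongrightarrow> coord \<phi> t) (nhds (coord \<phi>' t))"
    using has_derivative_continuous[OF \<sigma>'] \<sigma>t
    by (metis isCont_def tendsto_at_iff_tendsto_nhds)
  have "isCont (\<lambda>s. F (\<sigma> s)) (coord \<phi>' t)"
    using has_derivative_continuous[OF F\<sigma>'] .
  then have limF: "((\<lambda>s. F (\<sigma> s)) \<longlongrightarrow> coord \<psi> (f t)) (nhds (coord \<phi>' t))"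
    using \<sigma>t Ft tendsto_at_iff_tendsto_nhds[of "\<lambda>s. F (\<sigma> s)" "coord \<phi>' t"]
    by (simp add: isCont_def)
  have evU: "\<forall>\<^sub>F s in nhds (coord \<phi>' t). s \<in> U"
    unfolding U_def using charts dom jet' T.open_overlap by (intro eventually_nhds_in_open) auto
  have evD: "\<forall>\<^sub>F s in nhds (coord \<phi>' t). f (param \<phi> (\<sigma> s)) \<in> dom_of \<psi>"
    using eventually_compose_filterlim[OF jet'(3) lim] .
  have "\<forall>\<^sub>F y in nhds (coord \<psi> (f t)). y \<in> V"
    unfolding V_def using charts dom jet' M.open_overlap by (intro eventually_nhds_in_open) auto
  then have evV: "\<forall>\<^sub>F s in nhds (coord \<phi>' t). F (\<sigma> s) \<in> V"
    using eventually_compose_filterlim[OF _ limF] by blast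
  have ev: "\<forall>\<^sub>F s in nhds (coord \<phi>' t). f (param \<phi>' s) \<in> dom_of \<psi>' \<and>
      transition \<psi> \<psi>' (F (\<sigma> s)) = (coord \<psi>' \<circ> f \<circ> param \<phi>') s"
    using evU evD evV
  proof eventually_elim
    case (elim s)
    obtain y where y: "y \<in> dom_of \<phi>'" "y \<in> dom_of \<phi>" "s = coord \<phi>' y"
      using elim(1) by (auto simp: U_def)
    have \<sigma>s: "param \<phi> (\<sigma> s) = y" "param \<phi>' s = y"
      using y charts by (simp_all add: \<sigma>_def T.transition_coord T.param_coord)
    obtain m where m: "m \<in> dom_of \<psi>" "m \<in> dom_of \<psi>'" "coord \<psi> (f y) = coord \<psi> m"
      using elim(3) \<sigma>s by (auto simp: V_def F_def)
    moreover have "f y \<in> dom_of \<psi>"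
      using elim(2) \<sigma>s by simp
    ultimately have "f y = m"
      using M.inj_coord[OF charts(2)] by (simp add: inj_on_def)
    then show ?case
      using m \<sigma>s charts by (simp add: F_def M.transition_coord)
  qed
  have "((coord \<psi>' \<circ> f \<circ> param \<phi>') has_derivative
      (\<lambda>v. M.Dtrans \<psi> \<psi>' (f t) (D (T.Dtrans \<phi>' \<phi> t v)))) (at (coord \<phi>' t))"
  proof (rule has_derivative_transform_eventually[OF \<xi>F\<sigma>'])
    show "\<forall>\<^sub>F s in at (coord \<phi>' t). transition \<psi> \<psi>' (F (\<sigma> s)) = (coord \<psi>' \<circ> f \<circ> param \<phi>') s"
      using ev by (auto simp: eventually_at_filter elim: eventually_mono)
    show "transition \<psi> \<psi>' (F (\<sigma> (coord \<phi>' t))) = (coord \<psi>' \<circ> f \<circ> param \<phi>') (coord \<phi>' t)"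
      using eventually_nhds_x_imp_x[OF ev] by simp
  qed simp
  then show ?thesis
    using ev dom by (auto simp: has_jet_derivative_def elim: eventually_mono)
qed

lemma smooth_near_has_jet_derivative:
  assumes "smooth_near T M f t" and "\<phi> \<in> charts T" "\<psi> \<in> charts M" "t \<in> dom_of \<phi>" "f t \<in> dom_of \<psi>"
  obtains D where "has_jet_derivative \<phi> \<psi> t f D"
proof -
  obtain \<phi>0 \<psi>0 W where 0: "\<phi>0 \<in> charts T" "\<psi>0 \<in> charts M" "openin (mtop T) W" "t \<in> W"
      "W \<subseteq> dom_of \<phi>0" "f ` W \<subseteq> dom_of \<psi>0" "smooth_on (coord \<phi>0 ` W) (coord \<psi>0 \<circ> f \<circ> param \<phi>0)"
    using assms(1) unfolding smooth_near_def by blast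
  have "openin (subtopology (mtop T) (dom_of \<phi>0)) W"
    using 0 openin_subtopology_Int2[of "mtop T" W "dom_of \<phi>0"] by (simp add: inf_absorb2)
  then have "openin (top_of_set (coord \<phi>0 ` dom_of \<phi>0)) (coord \<phi>0 ` W)"
    using homeomorphic_imp_open_map[OF smooth_manifold_charts(2)[OF smooth_T 0(1)]]
    by (simp add: open_map_def)
  then have "open (coord \<phi>0 ` W)"
    using T.open_image[OF 0(1)] openin_open_trans by blast
  then have "\<forall>\<^sub>F s in nhds (coord \<phi>0 t). s \<in> coord \<phi>0 ` W"
    using 0 by (intro eventually_nhds_in_open) auto
  then have "\<forall>\<^sub>F s in nhds (coord \<phi>0 t). f (param \<phi>0 s) \<in> dom_of \<psi>0"
  proof eventually_elim
    case (elim s)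
    then obtain y where y: "y \<in> W" "s = coord \<phi>0 y" by blast
    then have "param \<phi>0 s = y" using 0 T.param_coord[OF 0(1)] by blast
    then show ?case using 0 y by auto
  qed
  moreover have "(coord \<psi>0 \<circ> f \<circ> param \<phi>0) differentiable (at (coord \<phi>0 t))"
    using 0 by (intro smooth_on_imp_differentiable[OF 0(7)]) auto
  ultimately obtain D where "has_jet_derivative \<phi>0 \<psi>0 t f D"
    using 0 unfolding has_jet_derivative_def differentiable_def by blast
  from has_jet_derivative_change[OF 0(1,2) assms(2-5) this] that show thesis by blast
qed

lemma jet_matrix_eq: "has_jet_derivative \<phi> \<psi> t f D \<Longrightarrow> jet_matrix \<phi> \<psi> t f = matrix D"
  using frechet_derivative_at[of "coord \<psi> \<circ> f \<circ> param \<phi>" D "coord \<phi> t"]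
  by (simp add: has_jet_derivative_def jet_matrix_def jacobian_def)

text \<open>The rule \<open>x~\<^sup>i\<^sub>\<alpha> = (\<partial>x~\<^sup>i/\<partial>x\<^sup>j) (\<partial>t\<^sup>\<beta>/\<partial>t~\<^sup>\<alpha>) x\<^sup>j\<^sub>\<beta>\<close>, in matrix form. It also shows that
  agreement of jet matrices in one pair of charts implies agreement in all of them.\<close>

lemma jet_matrix_change:
  assumes "smooth_near T M f t"
    and charts: "\<phi> \<in> charts T" "\<psi> \<in> charts M" "\<phi>' \<in> charts T" "\<psi>' \<in> charts M"
    and dom: "t \<in> dom_of \<phi>" "f t \<in> dom_of \<psi>" "t \<in> dom_of \<phi>'" "f t \<in> dom_of \<psi>'"
  shows "jet_matrix \<phi>' \<psi>' t f =
    jacobian (transition \<psi> \<psi>') (at (coord \<psi> (f t))) ** jet_matrix \<phi> \<psi> t f **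
    jacobian (transition \<phi>' \<phi>) (at (coord \<phi>' t))"
proof -
  obtain D where D: "has_jet_derivative \<phi> \<psi> t f D"
    using smooth_near_has_jet_derivative[OF assms(1) charts(1,2) dom(1,2)] .
  have lin: "linear D" "linear (M.Dtrans \<psi> \<psi>' (f t))" "linear (T.Dtrans \<phi>' \<phi> t)"
    using D has_derivative_linear charts dom M.linear_Dtrans T.linear_Dtrans
    unfolding has_jet_derivative_def by blast+
  have "jet_matrix \<phi>' \<psi>' t f = matrix (M.Dtrans \<psi> \<psi>' (f t) \<circ> D \<circ> T.Dtrans \<phi>' \<phi> t)"
    using jet_matrix_eq[OF has_jet_derivative_change[OF charts dom(3,4) D]] by (simp add: comp_def)
  also have "\<dots> = matrix (M.Dtrans \<psi> \<psi>' (f t)) ** matrix D ** matrix (T.Dtrans \<phi>' \<phi> t)"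
    using lin by (simp add: matrix_compose linear_compose)
  finally show ?thesis
    by (simp add: jet_matrix_eq[OF D] jacobian_def M.Dtrans_def T.Dtrans_def)
qed

text \<open>The map that is affine with slope \<open>Z\<close> in the two charts is a representative. It is smooth only
  on the preimage of \<open>coord \<psi> ` dom_of \<psi>\<close>; its values elsewhere are arbitrary, which a jet ignores.\<close>

lemma jet_exists:
  assumes charts: "\<phi> \<in> charts T" "\<psi> \<in> charts M" and dom: "t \<in> dom_of \<phi>" "x \<in> dom_of \<psi>"
  obtains f where "(t, f) \<in> jet_reps T M" "f t = x" "jet_matrix \<phi> \<psi> t f = Z"
proof -
  define g where "g s = coord \<psi> x + Z *v (s - coord \<phi> t)" for s
  define f where "f = (\<lambda>s. param \<psi> (g (coord \<phi> s)))"
  define U where "U = coord \<phi> ` dom_of \<phi> \<inter> g -` (coord \<psi> ` dom_of \<psi>)"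
  define W where "W = {s \<in> dom_of \<phi>. coord \<phi> s \<in> U}"
  have gt: "g (coord \<phi> t) = coord \<psi> x"
    by (simp add: g_def)
  have lin: "bounded_linear ((*v) Z)"
    by simp
  have g_alt: "g = (\<lambda>s. (coord \<psi> x - Z *v coord \<phi> t) + Z *v s)"
    by (auto simp: g_def matrix_vector_mult_diff_distrib)
  have der: "(g has_derivative (*v) Z) (at s)" for s
    unfolding g_alt
    using has_derivative_add[OF has_derivative_const bounded_linear_imp_has_derivative[OF lin]] by simp
  have "continuous_on UNIV g"
    by (intro continuous_at_imp_continuous_on ballI has_derivative_continuous[OF der])
  then have U: "open U"
    unfolding U_def using charts
    by (intro open_Int open_vimage T.open_image M.open_image)
  have W_coord: "coord \<phi> ` W = U"
    by (auto simp: W_def U_def)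
  have hom: "homeomorphic_map (subtopology (mtop T) (dom_of \<phi>))
      (top_of_set (coord \<phi> ` dom_of \<phi>)) (coord \<phi>)"
    by (rule smooth_manifold_charts(2)[OF smooth_T charts(1)])
  have "openin (top_of_set (coord \<phi> ` dom_of \<phi>)) U"
    using U by (auto simp: U_def intro: open_subset)
  from openin_continuous_map_preimage[OF homeomorphic_imp_continuous_map[OF hom] this]
  have "openin (subtopology (mtop T) (dom_of \<phi>)) W"
    using smooth_manifold_charts(4)[OF smooth_T charts(1)]
    by (simp add: W_def topspace_subtopology inf_absorb2)
  then have W: "openin (mtop T) W"
    using smooth_manifold_charts(1)[OF smooth_T charts(1)] openin_trans_full by blast
  have tW: "t \<in> W"
    using dom gt by (auto simp: W_def U_def)
  have repr: "(coord \<psi> \<circ> f \<circ> param \<phi>) s = g s" and f_dom: "f (param \<phi> s) \<in> dom_of \<psi>" if "s \<in> U" for s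
    using that charts by (auto simp: f_def U_def T.param_coord M.param_coord)
  have fx: "f t = x"
    using charts dom by (simp add: f_def gt M.param_coord)
  have "smooth_on U (\<lambda>s. (coord \<psi> x - Z *v coord \<phi> t) + Z *v s)"
    using U lin by (intro smooth_on_add smooth_on_const smooth_on_linear)
  then have "smooth_on U (coord \<psi> \<circ> f \<circ> param \<phi>)"
    using smooth_on_cong[OF U, of g] repr g_alt by simp
  moreover have "f ` W \<subseteq> dom_of \<psi>"
  proof
    fix y assume "y \<in> f ` W"
    then obtain s where s: "y = f s" "s \<in> dom_of \<phi>" "coord \<phi> s \<in> U"
      by (auto simp: W_def)
    then show "y \<in> dom_of \<psi>"
      using f_dom[OF s(3)] T.param_coord[OF charts(1) s(2)] by simp
  qed
  ultimately have "smooth_near T M f t"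
    unfolding smooth_near_def
    using charts W tW W_coord by (intro bexI[of _ \<phi>] bexI[of _ \<psi>] exI[of _ W]) (auto simp: W_def)
  then have rep: "(t, f) \<in> jet_reps T M"
    using dom smooth_manifold_charts(4)[OF smooth_T charts(1)] by (auto simp: jet_reps_def)
  have "coord \<phi> t \<in> U"
    using tW by (simp add: W_def)
  then have "((coord \<psi> \<circ> f \<circ> param \<phi>) has_derivative (*v) Z) (at (coord \<phi> t))"
    using repr by (intro has_derivative_transform_within_open[OF der U]) auto
  from frechet_derivative_at[OF this, symmetric]
  have "jet_matrix \<phi> \<psi> t f = Z"
    unfolding jet_matrix_def jacobian_def by simp
  with rep fx that show thesis by blast
qed

lemma equiv_jet_rel: "equiv (jet_reps T M) (jet_rel T M)"
proof (intro equivI refl_onI symI transI)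
  fix p q r assume "(p, q) \<in> jet_rel T M" "(q, r) \<in> jet_rel T M"
  then show "(p, r) \<in> jet_rel T M" by (cases p; cases q; cases r) (simp add: jet_rel_def)
next
  fix p q assume "(p, q) \<in> jet_rel T M"
  then show "(q, p) \<in> jet_rel T M" by (cases p; cases q) (simp add: jet_rel_def)
next
  fix p assume "p \<in> jet_reps T M"
  then show "(p, p) \<in> jet_rel T M" by (cases p) (simp add: jet_rel_def)
next
  show "jet_rel T M \<subseteq> jet_reps T M \<times> jet_reps T M"
    by (auto simp: jet_rel_def)
qed

lemma J1_cases:
  assumes "e \<in> J1 T M"
  obtains t f where "(t, f) \<in> e" "(t, f) \<in> jet_reps T M"
proof -
  obtain p where p: "p \<in> jet_reps T M" "e = jet_rel T M `` {p}"
    using assms unfolding J1_def by (rule quotientE)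
  then have "p \<in> e"
    using equiv_class_self[OF equiv_jet_rel] by simp
  moreover obtain t f where "p = (t, f)" by (cases p)
  ultimately show thesis using that[of t f] p(1) by simp
qed

lemma J1_reps_related:
  "e \<in> J1 T M \<Longrightarrow> p \<in> e \<Longrightarrow> q \<in> e \<Longrightarrow> (p, q) \<in> jet_rel T M"
  using in_quotient_imp_in_rel[OF equiv_jet_rel, of e p q] by (simp add: J1_def)

lemma J1_class:
  assumes "(t, f) \<in> jet_reps T M"
  obtains e where "e \<in> J1 T M" "(t, f) \<in> e"
proof
  show "jet_rel T M `` {(t, f)} \<in> J1 T M"
    unfolding J1_def using assms by (rule quotientI)
  show "(t, f) \<in> jet_rel T M `` {(t, f)}"
    using equiv_class_self[OF equiv_jet_rel assms] .
qed

lemma dom_induced_chart_iff: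
  assumes "e \<in> J1 T M" and "(t, f) \<in> e"
  shows "e \<in> dom_of (induced_chart T M \<phi> \<psi>) \<longleftrightarrow> t \<in> dom_of \<phi> \<and> f t \<in> dom_of \<psi>"
proof -
  have same_point: "s = t \<and> g s = f t" if "(s, g) \<in> e" for s g
    using J1_reps_related[OF assms(1) that assms(2)] by (simp add: jet_rel_def)
  have "(\<exists>(s, g)\<in>e. s \<in> dom_of \<phi> \<and> g s \<in> dom_of \<psi>) \<longleftrightarrow> t \<in> dom_of \<phi> \<and> f t \<in> dom_of \<psi>"
  proof
    assume "\<exists>(s, g)\<in>e. s \<in> dom_of \<phi> \<and> g s \<in> dom_of \<psi>"
    then obtain s g where "(s, g) \<in> e" "s \<in> dom_of \<phi>" "g s \<in> dom_of \<psi>" by blast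
    then show "t \<in> dom_of \<phi> \<and> f t \<in> dom_of \<psi>" using same_point[of s g] by simp
  qed (use assms(2) in blast)
  then show ?thesis
    using assms(1) by (simp add: induced_chart_def)
qed

lemma coord_induced_chart:
  assumes "e \<in> J1 T M" and "(t, f) \<in> e" and "\<phi> \<in> charts T" "\<psi> \<in> charts M"
    and "t \<in> dom_of \<phi>" "f t \<in> dom_of \<psi>"
  shows "coord (induced_chart T M \<phi> \<psi>) e = (coord \<phi> t, coord \<psi> (f t), jet_matrix \<phi> \<psi> t f)"
proof -
  define F where "F = (\<lambda>(t, f). (coord \<phi> t, coord \<psi> (f t), jet_matrix \<phi> \<psi> t f))"
  have same: "F q = F (t, f)" if "q \<in> e" for q
    using J1_reps_related[OF assms(1) that assms(2)] assms(3-6)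
    by (cases q) (simp add: jet_rel_def F_def)
  have "the_elem (F ` e) = F (t, f)"
    by (rule the_elem_image_unique[OF _ same]) (use assms(2) in blast)
  then show ?thesis
    by (simp add: induced_chart_def induced_coord_def F_def)
qed

lemma induced_chart_cases:
  assumes "e \<in> dom_of (induced_chart T M \<phi> \<psi>)" and "\<phi> \<in> charts T" "\<psi> \<in> charts M"
  obtains t f where "e \<in> J1 T M" "(t, f) \<in> e" "smooth_near T M f t" "t \<in> dom_of \<phi>" "f t \<in> dom_of \<psi>"
    "coord (induced_chart T M \<phi> \<psi>) e = (coord \<phi> t, coord \<psi> (f t), jet_matrix \<phi> \<psi> t f)"
proof -
  have e: "e \<in> J1 T M"
    using assms(1) by (simp add: induced_chart_def)
  obtain t f where tf: "(t, f) \<in> e" "(t, f) \<in> jet_reps T M"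
    using J1_cases[OF e] .
  moreover have "t \<in> dom_of \<phi>" "f t \<in> dom_of \<psi>"
    using dom_induced_chart_iff[OF e tf(1)] assms(1) by auto
  moreover have "smooth_near T M f t"
    using tf(2) by (simp add: jet_reps_def)
  ultimately show thesis
    using that[OF e] coord_induced_chart[OF e tf(1) assms(2,3)] by simp
qed

text \<open>Two jets with the same coordinates in one induced chart have representatives with the same
  source, target and jet matrix there; by \<open>jet_matrix_change\<close> the jet matrices then agree in all
  charts, which is the defining equivalence of jets.\<close>

lemma inj_induced_coord:
  assumes charts: "\<phi> \<in> charts T" "\<psi> \<in> charts M"
  shows "inj_on (coord (induced_chart T M \<phi> \<psi>)) (dom_of (induced_chart T M \<phi> \<psi>))"
proof (rule inj_onI)
  fix e e'
  assume dom: "e \<in> dom_of (induced_chart T M \<phi> \<psi>)" "e' \<in> dom_of (induced_chart T M \<phi> \<psi>)"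
    and eq: "coord (induced_chart T M \<phi> \<psi>) e = coord (induced_chart T M \<phi> \<psi>) e'"
  obtain t f where e: "e \<in> J1 T M" "(t, f) \<in> e" "smooth_near T M f t" "t \<in> dom_of \<phi>" "f t \<in> dom_of \<psi>"
    "coord (induced_chart T M \<phi> \<psi>) e = (coord \<phi> t, coord \<psi> (f t), jet_matrix \<phi> \<psi> t f)"
    using induced_chart_cases[OF dom(1) charts] .
  obtain t' g where e': "e' \<in> J1 T M" "(t', g) \<in> e'" "smooth_near T M g t'" "t' \<in> dom_of \<phi>" "g t' \<in> dom_of \<psi>"
    "coord (induced_chart T M \<phi> \<psi>) e' = (coord \<phi> t', coord \<psi> (g t'), jet_matrix \<phi> \<psi> t' g)"
    using induced_chart_cases[OF dom(2) charts] .
  have t: "t' = t"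
    using eq e e' T.inj_coord[OF charts(1)] by (auto simp: inj_on_def)
  have x: "g t = f t"
    using eq e e' t M.inj_coord[OF charts(2)] by (auto simp: inj_on_def)
  have z: "jet_matrix \<phi> \<psi> t g = jet_matrix \<phi> \<psi> t f"
    using eq e(6) e'(6) t by simp
  have "jet_matrix \<phi>' \<psi>' t f = jet_matrix \<phi>' \<psi>' t g"
    if "\<phi>' \<in> charts T" "\<psi>' \<in> charts M" "t \<in> dom_of \<phi>'" "f t \<in> dom_of \<psi>'" for \<phi>' \<psi>'
    using jet_matrix_change[OF e(3) charts that(1,2) e(4,5) that(3,4)]
      jet_matrix_change[OF e'(3) charts that(1,2) e'(4,5)] that x z by (simp add: t)
  moreover have "t \<in> topspace (mtop T)"
    using e(4) smooth_manifold_charts(4)[OF smooth_T charts(1)] by blast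
  ultimately have "((t, f), (t', g)) \<in> jet_rel T M"
    using e(3) e'(3) t x by (auto simp: jet_rel_def jet_reps_def)
  then show "e = e'"
    using quotient_eq_iff[OF equiv_jet_rel] e e' by (auto simp: J1_def)
qed

text \<open>The domain of an induced chart restricts only source and target of a jet, so the fibre
  coordinate ranges over all matrices. In particular the image is open.\<close>

lemma induced_coord_image_overlap:
  assumes charts: "\<phi> \<in> charts T" "\<psi> \<in> charts M" "\<phi>' \<in> charts T" "\<psi>' \<in> charts M"
  shows "coord (induced_chart T M \<phi> \<psi>) `
      (dom_of (induced_chart T M \<phi> \<psi>) \<inter> dom_of (induced_chart T M \<phi>' \<psi>')) =
    (coord \<phi> ` (dom_of \<phi> \<inter> dom_of \<phi>')) \<times> (coord \<psi> ` (dom_of \<psi> \<inter> dom_of \<psi>')) \<times> UNIV"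
    (is "?L = ?R")
proof
  show "?L \<subseteq> ?R"
  proof
    fix p assume "p \<in> ?L"
    then obtain e where e: "e \<in> dom_of (induced_chart T M \<phi> \<psi>)"
        "e \<in> dom_of (induced_chart T M \<phi>' \<psi>')" "p = coord (induced_chart T M \<phi> \<psi>) e"
      by blast
    from induced_chart_cases[OF e(1) charts(1,2)] obtain t f where
      tf: "e \<in> J1 T M" "(t, f) \<in> e" "t \<in> dom_of \<phi>" "f t \<in> dom_of \<psi>"
        "p = (coord \<phi> t, coord \<psi> (f t), jet_matrix \<phi> \<psi> t f)"
      using e(3) by metis
    then show "p \<in> ?R"
      using dom_induced_chart_iff[OF tf(1,2)] e(2) by auto
  qed
  show "?R \<subseteq> ?L"
  proof
    fix p assume "p \<in> ?R"
    then obtain t x Z where p: "p = (coord \<phi> t, coord \<psi> x, Z)" "t \<in> dom_of \<phi>" "t \<in> dom_of \<phi>'"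
        "x \<in> dom_of \<psi>" "x \<in> dom_of \<psi>'"
      by auto
    obtain f where f: "(t, f) \<in> jet_reps T M" "f t = x" "jet_matrix \<phi> \<psi> t f = Z"
      using jet_exists[OF charts(1,2) p(2,4)] .
    obtain e where e: "e \<in> J1 T M" "(t, f) \<in> e"
      using J1_class[OF f(1)] .
    have "e \<in> dom_of (induced_chart T M \<phi> \<psi>) \<inter> dom_of (induced_chart T M \<phi>' \<psi>')"
      using dom_induced_chart_iff[OF e] p f(2) by auto
    moreover have "coord (induced_chart T M \<phi> \<psi>) e = p"
      using coord_induced_chart[OF e charts(1,2)] p f by simp
    ultimately show "p \<in> ?L" by blast
  qed
qed

definition jet_coord_change :: "('t, real^'p) chart \<Rightarrow> ('m, real^'n) chart \<Rightarrow>
    ('t, real^'p) chart \<Rightarrow> ('m, real^'n) chart \<Rightarrow> ('p, 'n) jet_coords \<Rightarrow> ('p, 'n) jet_coords"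
  where "jet_coord_change \<phi> \<psi> \<phi>' \<psi>' = (\<lambda>(t, x, z).
    (transition \<phi> \<phi>' t, transition \<psi> \<psi>' x,
     jacobian (transition \<psi> \<psi>') (at x) ** z **
       jacobian (transition \<phi>' \<phi>) (at (transition \<phi> \<phi>' t))))"

lemma jet_coord_change_coord:
  assumes charts: "\<phi> \<in> charts T" "\<psi> \<in> charts M" "\<phi>' \<in> charts T" "\<psi>' \<in> charts M"
    and dom: "e \<in> dom_of (induced_chart T M \<phi> \<psi>)" "e \<in> dom_of (induced_chart T M \<phi>' \<psi>')"
  shows "jet_coord_change \<phi> \<psi> \<phi>' \<psi>' (coord (induced_chart T M \<phi> \<psi>) e) =
    coord (induced_chart T M \<phi>' \<psi>') e"
proof -
  obtain t f where e: "e \<in> J1 T M" "(t, f) \<in> e" "smooth_near T M f t" "t \<in> dom_of \<phi>" "f t \<in> dom_of \<psi>"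
    "coord (induced_chart T M \<phi> \<psi>) e = (coord \<phi> t, coord \<psi> (f t), jet_matrix \<phi> \<psi> t f)"
    using induced_chart_cases[OF dom(1) charts(1,2)] .
  have d': "t \<in> dom_of \<phi>'" "f t \<in> dom_of \<psi>'"
    using dom_induced_chart_iff[OF e(1,2)] dom(2) by auto
  show ?thesis
    using e(6) coord_induced_chart[OF e(1,2) charts(3,4) d'] charts e(4,5)
      jet_matrix_change[OF e(3) charts e(4,5) d']
    by (simp add: jet_coord_change_def T.transition_coord M.transition_coord)
qed

text \<open>The change of base coordinates does not involve the fibre coordinate, and the change of the
  fibre coordinate is linear in it; this gives the block form of \<open>D\<close>. That \<open>D\<close> exists at all uses the
  second derivatives of the coordinate changes of \<open>T\<close> and \<open>M\<close>.\<close>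

lemma jet_coord_change_has_derivative:
  assumes charts: "\<phi> \<in> charts T" "\<psi> \<in> charts M" "\<phi>' \<in> charts T" "\<psi>' \<in> charts M"
    and dom: "t \<in> dom_of \<phi>" "x \<in> dom_of \<psi>" "t \<in> dom_of \<phi>'" "x \<in> dom_of \<psi>'"
  obtains D where
    "(jet_coord_change \<phi> \<psi> \<phi>' \<psi>' has_derivative D) (at (coord \<phi> t, coord \<psi> x, z))"
    "\<And>u. fst (D u) = jacobian (transition \<phi> \<phi>') (at (coord \<phi> t)) *v fst u"
    "\<And>u. fst (snd (D u)) = jacobian (transition \<psi> \<psi>') (at (coord \<psi> x)) *v fst (snd u)"
    "\<And>w. snd (snd (D (0, 0, w))) = jacobian (transition \<psi> \<psi>') (at (coord \<psi> x)) ** w **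
      jacobian (transition \<phi>' \<phi>) (at (coord \<phi>' t))"
proof -
  define \<tau> where "\<tau> = transition \<phi> \<phi>'"
  define \<sigma> where "\<sigma> = transition \<phi>' \<phi>"
  define \<xi> where "\<xi> = transition \<psi> \<psi>'"
  define A where "A y = jacobian \<xi> (at y)" for y
  define B where "B s = jacobian \<sigma> (at (\<tau> s))" for s
  define p where "p = (coord \<phi> t, coord \<psi> x, z)"
  have \<tau>t: "\<tau> (coord \<phi> t) = coord \<phi>' t"
    using charts dom by (simp add: \<tau>_def T.transition_coord)
  have \<tau>': "(\<tau> has_derivative (*v) (jacobian \<tau> (at (coord \<phi> t)))) (at (coord \<phi> t))"
    using T.transition_differentiable[of \<phi> \<phi>' t] charts dom jacobian_works
    unfolding \<tau>_def by blast
  have \<xi>': "(\<xi> has_derivative (*v) (jacobian \<xi> (at (coord \<psi> x)))) (at (coord \<psi> x))"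
    using M.transition_differentiable[of \<psi> \<psi>' x] charts dom jacobian_works
    unfolding \<xi>_def by blast
  have "A differentiable (at (coord \<psi> x))"
    unfolding A_def \<xi>_def using dom
    by (intro differentiable_jacobian[OF smooth_on_transition[OF smooth_M charts(2,4)]]) auto
  then obtain A' where A': "(A has_derivative A') (at (coord \<psi> x))"
    by (auto simp: differentiable_def)
  have "(\<lambda>s. jacobian \<sigma> (at s)) differentiable (at (\<tau> (coord \<phi> t)))"
    unfolding \<sigma>_def \<tau>t using dom
    by (intro differentiable_jacobian[OF smooth_on_transition[OF smooth_T charts(3,1)]]) auto
  then obtain S' where "((\<lambda>s. jacobian \<sigma> (at s)) has_derivative S') (at (\<tau> (coord \<phi> t)))"
    by (auto simp: differentiable_def)
  from has_derivative_compose[OF \<tau>' this]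
  obtain B' where B': "(B has_derivative B') (at (coord \<phi> t))"
    by (auto simp: B_def[abs_def])
  have pt: "(fst has_derivative fst) (at p)"
    by (rule bounded_linear_imp_has_derivative[OF bounded_linear_fst])
  have pxz: "(snd has_derivative snd) (at p)"
    by (rule bounded_linear_imp_has_derivative[OF bounded_linear_snd])
  have px: "((\<lambda>q. fst (snd q)) has_derivative (\<lambda>u. fst (snd u))) (at p)"
    by (rule has_derivative_compose[OF pxz bounded_linear_imp_has_derivative[OF bounded_linear_fst]])
  have pz: "((\<lambda>q. snd (snd q)) has_derivative (\<lambda>u. snd (snd u))) (at p)"
    by (rule has_derivative_compose[OF pxz bounded_linear_imp_has_derivative[OF bounded_linear_snd]])
  have q1: "((\<lambda>q. \<tau> (fst q)) has_derivative (\<lambda>u. jacobian \<tau> (at (coord \<phi> t)) *v fst u)) (at p)"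
    using has_derivative_compose[OF pt, of \<tau>] \<tau>' by (simp add: p_def)
  have q2: "((\<lambda>q. \<xi> (fst (snd q))) has_derivative
      (\<lambda>u. jacobian \<xi> (at (coord \<psi> x)) *v fst (snd u))) (at p)"
    using has_derivative_compose[OF px, of \<xi>] \<xi>' by (simp add: p_def)
  have a: "((\<lambda>q. A (fst (snd q))) has_derivative (\<lambda>u. A' (fst (snd u)))) (at p)"
    using has_derivative_compose[OF px, of A] A' by (simp add: p_def)
  have b: "((\<lambda>q. B (fst q)) has_derivative (\<lambda>u. B' (fst u))) (at p)"
    using has_derivative_compose[OF pt, of B] B' by (simp add: p_def)
  note q3 = bounded_bilinear.FDERIV[OF bounded_bilinear_matrix_matrix_mult
      bounded_bilinear.FDERIV[OF bounded_bilinear_matrix_matrix_mult a pz] b]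
  \<comment> \<open>the product rule for \<open>A(x) z B(t)\<close>; on \<open>(0, 0, w)\<close> the terms with \<open>A'\<close> and \<open>B'\<close> vanish\<close>
  define D where "D u = (jacobian \<tau> (at (coord \<phi> t)) *v fst u,
      jacobian \<xi> (at (coord \<psi> x)) *v fst (snd u),
      A (coord \<psi> x) ** z ** B' (fst u) +
        (A (coord \<psi> x) ** snd (snd u) + A' (fst (snd u)) ** z) ** B (coord \<phi> t))" for u
  have "((\<lambda>q. (\<tau> (fst q), \<xi> (fst (snd q)), A (fst (snd q)) ** snd (snd q) ** B (fst q)))
      has_derivative D) (at p)"
    using has_derivative_Pair[OF q1 has_derivative_Pair[OF q2 q3]]
    by (simp add: p_def D_def[abs_def])
  moreover have "(\<lambda>q. (\<tau> (fst q), \<xi> (fst (snd q)), A (fst (snd q)) ** snd (snd q) ** B (fst q))) =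
      jet_coord_change \<phi> \<psi> \<phi>' \<psi>'"
    by (auto simp: jet_coord_change_def A_def B_def \<tau>_def \<sigma>_def \<xi>_def)
  ultimately have "(jet_coord_change \<phi> \<psi> \<phi>' \<psi>' has_derivative D) (at p)"
    by simp
  moreover have "A' 0 = 0" "B' 0 = 0"
    using A' B' has_derivative_linear linear_0 by blast+
  ultimately show thesis
    by (intro that[of D]) (simp_all add: D_def p_def A_def B_def \<tau>t[unfolded \<tau>_def] \<tau>_def \<sigma>_def \<xi>_def)
qed

lemma jet_transition_has_derivative:
  assumes charts: "\<phi> \<in> charts T" "\<psi> \<in> charts M" "\<phi>' \<in> charts T" "\<psi>' \<in> charts M"
    and dom: "e \<in> dom_of (induced_chart T M \<phi> \<psi>)" "e \<in> dom_of (induced_chart T M \<phi>' \<psi>')"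
    and D: "(jet_coord_change \<phi> \<psi> \<phi>' \<psi>' has_derivative D) (at (coord (induced_chart T M \<phi> \<psi>) e))"
  shows "(transition (induced_chart T M \<phi> \<psi>) (induced_chart T M \<phi>' \<psi>') has_derivative D)
    (at (coord (induced_chart T M \<phi> \<psi>) e))"
proof (rule has_derivative_transform_within_open[OF D])
  let ?c = "induced_chart T M \<phi> \<psi>" and ?c' = "induced_chart T M \<phi>' \<psi>'"
  show "open (coord ?c ` (dom_of ?c \<inter> dom_of ?c'))"
    unfolding induced_coord_image_overlap[OF charts]
    using charts by (intro open_Times T.open_overlap M.open_overlap open_UNIV)
  show "coord ?c e \<in> coord ?c ` (dom_of ?c \<inter> dom_of ?c')"
    using dom by blast
  fix p assume "p \<in> coord ?c ` (dom_of ?c \<inter> dom_of ?c')"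
  then obtain e' where e': "e' \<in> dom_of ?c" "e' \<in> dom_of ?c'" "p = coord ?c e'"
    by blast
  then show "jet_coord_change \<phi> \<psi> \<phi>' \<psi>' p = transition ?c ?c' p"
    using jet_coord_change_coord[OF charts e'(1,2)] inj_induced_coord[OF charts(1,2)]
    by (simp add: transition_def param_def)
qed

lemma jet_transition_derivative:
  assumes charts: "\<phi> \<in> charts T" "\<psi> \<in> charts M" "\<phi>' \<in> charts T" "\<psi>' \<in> charts M"
    and dom: "e \<in> dom_of (induced_chart T M \<phi> \<psi>)" "e \<in> dom_of (induced_chart T M \<phi>' \<psi>')"
    and coords: "coord (induced_chart T M \<phi> \<psi>) e = (t, x, z)"
      "coord (induced_chart T M \<phi>' \<psi>') e = (t', x', z')"
  obtains D where
    "(transition (induced_chart T M \<phi> \<psi>) (induced_chart T M \<phi>' \<psi>') has_derivative D) (at (t, x, z))"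
    "\<And>u. fst (D u) = jacobian (transition \<phi> \<phi>') (at t) *v fst u"
    "\<And>u. fst (snd (D u)) = jacobian (transition \<psi> \<psi>') (at x) *v fst (snd u)"
    "\<And>w. snd (snd (D (0, 0, w))) = jacobian (transition \<psi> \<psi>') (at x) ** w **
      jacobian (transition \<phi>' \<phi>) (at t')"
proof -
  obtain s f where e: "e \<in> J1 T M" "(s, f) \<in> e" "smooth_near T M f s" "s \<in> dom_of \<phi>" "f s \<in> dom_of \<psi>"
    "coord (induced_chart T M \<phi> \<psi>) e = (coord \<phi> s, coord \<psi> (f s), jet_matrix \<phi> \<psi> s f)"
    using induced_chart_cases[OF dom(1) charts(1,2)] .
  have d': "s \<in> dom_of \<phi>'" "f s \<in> dom_of \<psi>'"
    using dom_induced_chart_iff[OF e(1,2)] dom(2) by auto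
  have eq: "t = coord \<phi> s" "x = coord \<psi> (f s)" "t' = coord \<phi>' s"
    using e(6) coords coord_induced_chart[OF e(1,2) charts(3,4) d'] by auto
  obtain D where D:
    "(jet_coord_change \<phi> \<psi> \<phi>' \<psi>' has_derivative D) (at (coord \<phi> s, coord \<psi> (f s), z))"
    "\<And>u. fst (D u) = jacobian (transition \<phi> \<phi>') (at (coord \<phi> s)) *v fst u"
    "\<And>u. fst (snd (D u)) = jacobian (transition \<psi> \<psi>') (at (coord \<psi> (f s))) *v fst (snd u)"
    "\<And>w. snd (snd (D (0, 0, w))) = jacobian (transition \<psi> \<psi>') (at (coord \<psi> (f s))) ** w **
      jacobian (transition \<phi>' \<phi>) (at (coord \<phi>' s))"
    using jet_coord_change_has_derivative[OF charts e(4,5) d'] by blast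
  show thesis
  proof (rule that)
    show "(transition (induced_chart T M \<phi> \<psi>) (induced_chart T M \<phi>' \<psi>') has_derivative D) (at (t, x, z))"
      using jet_transition_has_derivative[OF charts dom, of D] D(1) coords(1) eq by simp
  qed (use D(2-4) eq in auto)
qed

lemma induced_chart_in_jet_atlas:
  "\<phi> \<in> charts T \<Longrightarrow> \<psi> \<in> charts M \<Longrightarrow> induced_chart T M \<phi> \<psi> \<in> jet_atlas T M"
  unfolding jet_atlas_def by blast

sublocale J: differentiable_atlas "jet_atlas T M"
proof
  fix c assume "c \<in> jet_atlas T M"
  then show "inj_on (coord c) (dom_of c)"
    using inj_induced_coord by (auto simp: jet_atlas_def simp del: split_paired_All)
next
  fix c d assume "c \<in> jet_atlas T M" "d \<in> jet_atlas T M"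
  then obtain \<phi> \<psi> \<phi>' \<psi>' where cd: "c = induced_chart T M \<phi> \<psi>" "d = induced_chart T M \<phi>' \<psi>'"
    and charts: "\<phi> \<in> charts T" "\<psi> \<in> charts M" "\<phi>' \<in> charts T" "\<psi>' \<in> charts M"
    by (auto simp: jet_atlas_def)
  show "open (coord c ` (dom_of c \<inter> dom_of d))"
    unfolding cd induced_coord_image_overlap[OF charts]
    using charts by (intro open_Times T.open_overlap M.open_overlap open_UNIV)
next
  fix c d e assume "c \<in> jet_atlas T M" "d \<in> jet_atlas T M" and dom: "e \<in> dom_of c" "e \<in> dom_of d"
  then obtain \<phi> \<psi> \<phi>' \<psi>' where cd: "c = induced_chart T M \<phi> \<psi>" "d = induced_chart T M \<phi>' \<psi>'"
    and charts: "\<phi> \<in> charts T" "\<psi> \<in> charts M" "\<phi>' \<in> charts T" "\<psi>' \<in> charts M"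
    by (auto simp: jet_atlas_def)
  obtain t x z t' x' z' where coords: "coord c e = (t, x, z)" "coord d e = (t', x', z')"
    by (metis prod.exhaust)
  obtain D where "(transition c d has_derivative D) (at (t, x, z))"
    using jet_transition_derivative[OF charts dom[unfolded cd] coords[unfolded cd]]
    unfolding cd by metis
  then show "transition c d differentiable (at (coord c e))"
    unfolding coords(1) by (rule differentiableI)
qed

end

section \<open>Temporal sprays and temporal nonlinear connections\<close>

text \<open>The endomorphism \<open>dt\<^sup>\<alpha> \<otimes> \<partial>/\<partial>t\<^sup>\<alpha> - 2 h\<^sup>(\<^sup>j\<^sup>)\<^sub>(\<^sub>\<beta>\<^sub>)\<^sub>\<alpha> dt\<^sup>\<alpha> \<otimes> \<partial>/\<partial>x\<^sup>j\<^sub>\<beta>\<close> in the coordinates of an induced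
  chart; see \<open>spray_map_expansion\<close>.\<close>

definition spray_map :: "('n::finite \<Rightarrow> 'p::finite \<Rightarrow> 'p \<Rightarrow> real) \<Rightarrow> ('p, 'n) jet_coords \<Rightarrow> ('p, 'n) jet_coords"
  where "spray_map h u =
    (fst u, 0, - (2 *\<^sub>R (\<chi> j \<beta>. \<Sum>\<alpha>\<in>UNIV. h j \<beta> \<alpha> * fst u $ \<alpha>)))"

lemma spray_map_expansion:
  fixes h :: "'n::finite \<Rightarrow> 'p::finite \<Rightarrow> 'p \<Rightarrow> real"
  shows "(\<Sum>\<alpha>\<in>UNIV. (fst u $ \<alpha>) *\<^sub>R ddt \<alpha>)
     - 2 *\<^sub>R (\<Sum>j\<in>UNIV. \<Sum>\<beta>\<in>UNIV. \<Sum>\<alpha>\<in>UNIV. (h j \<beta> \<alpha> * (fst u $ \<alpha>)) *\<^sub>R ddz j \<beta>) = spray_map h u"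
proof -
  have t: "(\<Sum>\<alpha>\<in>UNIV. (fst u $ \<alpha>) *\<^sub>R axis \<alpha> 1) = fst u"
    using basis_expansion[of "fst u"] by (simp add: scalar_mult_eq_scaleR)
  define w where "w j \<beta> = (\<Sum>\<alpha>\<in>UNIV. h j \<beta> \<alpha> * fst u $ \<alpha>)" for j \<beta>
  have entry: "(r *\<^sub>R axis j (axis \<beta> 1)) $ i $ \<gamma> = (if \<beta> = \<gamma> then if j = i then r else 0 else 0)"
    for r :: real and j i :: 'n and \<beta> \<gamma> :: 'p
    by (simp add: axis_def)
  have "(\<Sum>j\<in>UNIV. \<Sum>\<beta>\<in>UNIV. w j \<beta> *\<^sub>R axis j (axis \<beta> 1)) $ i $ \<gamma> = w i \<gamma>" for i \<gamma>
    unfolding sum_component entry by simp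
  then have z: "(\<Sum>j\<in>UNIV. \<Sum>\<beta>\<in>UNIV. \<Sum>\<alpha>\<in>UNIV. (h j \<beta> \<alpha> * (fst u $ \<alpha>)) *\<^sub>R axis j (axis \<beta> 1)) =
      (\<chi> j \<beta>. \<Sum>\<alpha>\<in>UNIV. h j \<beta> \<alpha> * fst u $ \<alpha>)"
    by (simp add: vec_eq_iff w_def scaleR_sum_left)
  show ?thesis
    using t z by (simp add: spray_map_def prod_eq_iff fst_sum snd_sum ddt_def ddz_def)
qed

lemma linear_spray_map: "linear (spray_map h)"
  by (rule linearI)
    (auto simp: spray_map_def vec_eq_iff sum.distrib sum_distrib_left algebra_simps)

text \<open>The algebraic core. With \<open>P\<close>, \<open>Q\<close>, \<open>R\<close> the Jacobian matrices of \<open>\<tau>\<close>, \<open>\<xi>\<close>, \<open>\<sigma>\<close>, the right hand side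
  is the transformation law of a nonlinear connection with coefficients \<open>2 h\<close> and \<open>2 h'\<close>. Both images
  of \<open>u\<close> have the form \<open>(P a, 0, _)\<close> with \<open>a = fst u\<close>, and their last components \<open>- L a\<close> and \<open>- N a\<close>
  are linear in \<open>a\<close>, so it suffices to compare them on the basis vectors \<open>axis \<alpha> 1\<close>.\<close>

lemma spray_map_intertwines_iff:
  fixes D :: "('p::finite, 'n::finite) jet_coords \<Rightarrow> ('p, 'n) jet_coords"
  assumes lin: "linear D"
    and t: "\<And>u. fst (D u) = P *v fst u"
    and x: "\<And>u. fst (snd (D u)) = Q *v fst (snd u)"
    and z: "\<And>w. snd (snd (D (0, 0, w))) = Q ** w ** R"
  shows "(\<forall>u. spray_map h' (D u) = D (spray_map h u)) \<longleftrightarrow>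
    (\<forall>j \<beta> \<alpha>. (\<Sum>\<mu>\<in>UNIV. 2 * h' j \<beta> \<mu> * P $ \<mu> $ \<alpha>) =
      (\<Sum>k\<in>UNIV. \<Sum>\<gamma>\<in>UNIV. 2 * h k \<gamma> \<alpha> * Q $ j $ k * R $ \<gamma> $ \<beta>) - snd (snd (D (ddt \<alpha>))) $ j $ \<beta>)"
proof -
  define V where "V g a = (\<chi> j \<beta>. \<Sum>\<alpha>\<in>UNIV. g j \<beta> \<alpha> * a $ \<alpha>)" for g :: "'n \<Rightarrow> 'p \<Rightarrow> 'p \<Rightarrow> real" and a :: "real^'p"
  define L where "L a = 2 *\<^sub>R V h' (P *v a)" for a
  define N where "N a = 2 *\<^sub>R (Q ** V h a ** R) - snd (snd (D (a, 0, 0)))" for a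
  have split: "D (a, 0, w) = (P *v a, 0, snd (snd (D (a, 0, 0))) + Q ** w ** R)" for a w
  proof -
    have "D (a, 0, w) = D (a, 0, 0) + D (0, 0, w)"
      using linear_add[OF lin, of "(a, 0, 0)" "(0, 0, w)"] by simp
    then have "snd (snd (D (a, 0, w))) = snd (snd (D (a, 0, 0))) + Q ** w ** R"
      using z[of w] by simp
    then show ?thesis
      using t[of "(a, 0, w)"] x[of "(a, 0, w)"] by (intro prod_eqI) simp_all
  qed
  have mult: "Q ** (- (2 *\<^sub>R w)) ** R = - (2 *\<^sub>R (Q ** w ** R))" for w
    by (simp add: vec_eq_iff matrix_matrix_mult_def sum_distrib_left sum_distrib_right
        sum_negf algebra_simps)
  have left: "spray_map h' (D u) = (P *v fst u, 0, - L (fst u))" for u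
    by (simp add: spray_map_def t L_def V_def)
  have right: "D (spray_map h u) = (P *v fst u, 0, - N (fst u))" for u
    using split[of "fst u" "- (2 *\<^sub>R V h (fst u))"] unfolding mult
    by (simp add: spray_map_def N_def V_def[symmetric])
  have linL: "linear L"
    by (rule linearI) (auto simp: L_def V_def vec_eq_iff sum.distrib sum_distrib_left
        matrix_vector_mult_def algebra_simps)
  have linV: "linear (V h)"
    by (rule linearI) (auto simp: V_def vec_eq_iff sum.distrib sum_distrib_left algebra_simps)
  have "linear (\<lambda>a. Q ** V h a ** R)"
    by (rule linearI) (auto simp: linear_add[OF linV] linear_scale[OF linV] vec_eq_iff
        matrix_matrix_mult_def sum.distrib sum_distrib_left sum_distrib_right algebra_simps)
  moreover have "linear (\<lambda>a. snd (snd (D (a, 0, 0))))"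
    using linear_add[OF lin, of "(_, 0, 0)" "(_, 0, 0)"] linear_scale[OF lin, of _ "(_, 0, 0)"]
    by (intro linearI) simp_all
  ultimately have linN: "linear N"
    unfolding N_def by (intro linear_compose_sub linear_compose_scale_right)
  have entryL: "L (axis \<alpha> 1) $ j $ \<beta> = (\<Sum>\<mu>\<in>UNIV. 2 * h' j \<beta> \<mu> * P $ \<mu> $ \<alpha>)" for \<alpha> j \<beta>
    by (simp add: L_def V_def matrix_vector_mul_component inner_axis sum_distrib_left ac_simps)
  have entryV: "V h (axis \<alpha> 1) $ k $ \<gamma> = h k \<gamma> \<alpha>" for \<alpha> k \<gamma>
    by (simp add: V_def axis_def if_distrib cong: if_cong)
  have entryN: "N (axis \<alpha> 1) $ j $ \<beta> =
      (\<Sum>k\<in>UNIV. \<Sum>\<gamma>\<in>UNIV. 2 * h k \<gamma> \<alpha> * Q $ j $ k * R $ \<gamma> $ \<beta>) - snd (snd (D (ddt \<alpha>))) $ j $ \<beta>" for \<alpha> j \<beta>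
  proof -
    have "(Q ** V h (axis \<alpha> 1) ** R) $ j $ \<beta> =
        (\<Sum>\<gamma>\<in>UNIV. \<Sum>k\<in>UNIV. h k \<gamma> \<alpha> * Q $ j $ k * R $ \<gamma> $ \<beta>)"
      by (simp add: matrix_matrix_mult_def entryV sum_distrib_left sum_distrib_right ac_simps)
    also have "\<dots> = (\<Sum>k\<in>UNIV. \<Sum>\<gamma>\<in>UNIV. h k \<gamma> \<alpha> * Q $ j $ k * R $ \<gamma> $ \<beta>)"
      by (rule sum.swap)
    finally show ?thesis
      by (simp add: N_def ddt_def sum_distrib_left ac_simps)
  qed
  have "(\<forall>u. spray_map h' (D u) = D (spray_map h u)) \<longleftrightarrow>
      (\<forall>u :: ('p, 'n) jet_coords. L (fst u) = N (fst u))"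
    unfolding left right by simp
  also have "\<dots> \<longleftrightarrow> L = N"
    by (auto simp: fun_eq_iff)
  also have "\<dots> \<longleftrightarrow> (\<forall>\<alpha>. L (axis \<alpha> 1) = N (axis \<alpha> 1))"
    using linear_eq_stdbasis[OF linL linN] by (auto simp: Basis_vec_def)
  finally show ?thesis
    by (auto simp: vec_eq_iff entryL entryN)
qed

lemma smooth_family_scale:
  fixes T :: "('t, real^'p) manifold" and M :: "('m, real^'n) manifold"
  assumes "smooth_manifold T" "smooth_manifold M" and H: "smooth_family T M H"
  shows "smooth_family T M (\<lambda>\<phi> \<psi> j \<beta> \<alpha> e. r * H \<phi> \<psi> j \<beta> \<alpha> e)"
proof -
  interpret two_manifolds T M by unfold_locales fact+
  have "smooth_in_chart (induced_chart T M \<phi> \<psi>) (\<lambda>e. r * H \<phi> \<psi> j \<beta> \<alpha> e)"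
    if "\<phi> \<in> charts T" "\<psi> \<in> charts M" for \<phi> \<psi> j \<beta> \<alpha>
  proof -
    have "open (coord (induced_chart T M \<phi> \<psi>) ` dom_of (induced_chart T M \<phi> \<psi>))"
      using that by (intro J.open_image induced_chart_in_jet_atlas)
    moreover have "smooth_in_chart (induced_chart T M \<phi> \<psi>) (H \<phi> \<psi> j \<beta> \<alpha>)"
      using H that by (simp add: smooth_family_def)
    ultimately show ?thesis
      unfolding smooth_in_chart_def comp_def
      by (rule smooth_on_linear_compose[OF _ bounded_linear_mult_right])
  qed
  then show ?thesis
    by (simp add: smooth_family_def)
qed

context two_manifolds
begin

text \<open>The condition under which the local endomorphisms given by \<open>H\<close> fit together to one field of
  endomorphisms of the tangent spaces of the jet bundle.\<close>

definition spray_compatible :: "('t, 'm, 'p, 'n) local_family \<Rightarrow> bool"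
  where "spray_compatible H \<longleftrightarrow>
    (\<forall>\<phi>\<in>charts T. \<forall>\<psi>\<in>charts M. \<forall>\<phi>'\<in>charts T. \<forall>\<psi>'\<in>charts M.
       let c = induced_chart T M \<phi> \<psi>; c' = induced_chart T M \<phi>' \<psi>' in
       \<forall>e\<in>dom_of c \<inter> dom_of c'. \<forall>u.
         spray_map (\<lambda>j \<beta> \<alpha>. H \<phi>' \<psi>' j \<beta> \<alpha> e) (J.Dtrans c c' e u) =
         J.Dtrans c c' e (spray_map (\<lambda>j \<beta> \<alpha>. H \<phi> \<psi> j \<beta> \<alpha> e) u))"

lemma spray_compatibleD:
  assumes "spray_compatible H"
    and "\<phi> \<in> charts T" "\<psi> \<in> charts M" "\<phi>' \<in> charts T" "\<psi>' \<in> charts M"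
    and "e \<in> dom_of (induced_chart T M \<phi> \<psi>)" "e \<in> dom_of (induced_chart T M \<phi>' \<psi>')"
  shows "J.Dtrans (induced_chart T M \<phi> \<psi>) (induced_chart T M \<phi>' \<psi>') e
      (spray_map (\<lambda>j \<beta> \<alpha>. H \<phi> \<psi> j \<beta> \<alpha> e) u) =
    spray_map (\<lambda>j \<beta> \<alpha>. H \<phi>' \<psi>' j \<beta> \<alpha> e)
      (J.Dtrans (induced_chart T M \<phi> \<psi>) (induced_chart T M \<phi>' \<psi>') e u)"
  using assms unfolding spray_compatible_def Let_def by (metis IntI)

lemma temporal_nonlinear_connection_double_iff:
  assumes "smooth_family T M H"
  shows "temporal_nonlinear_connection T M (\<lambda>\<phi> \<psi> j \<beta> \<alpha> e. 2 * H \<phi> \<psi> j \<beta> \<alpha> e) \<longleftrightarrow> spray_compatible H"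
proof -
  have pointwise: "(\<forall>u. spray_map (\<lambda>j \<beta> \<alpha>. H \<phi>' \<psi>' j \<beta> \<alpha> e)
          (J.Dtrans (induced_chart T M \<phi> \<psi>) (induced_chart T M \<phi>' \<psi>') e u) =
        J.Dtrans (induced_chart T M \<phi> \<psi>) (induced_chart T M \<phi>' \<psi>') e
          (spray_map (\<lambda>j \<beta> \<alpha>. H \<phi> \<psi> j \<beta> \<alpha> e) u)) \<longleftrightarrow>
      (let (t, x, z) = coord (induced_chart T M \<phi> \<psi>) e;
           (t', x', z') = coord (induced_chart T M \<phi>' \<psi>') e in
       \<forall>j \<beta> \<alpha>. (\<Sum>\<mu>\<in>UNIV. 2 * H \<phi>' \<psi>' j \<beta> \<mu> e * jacobian (transition \<phi> \<phi>') (at t) $ \<mu> $ \<alpha>) =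
         (\<Sum>k\<in>UNIV. \<Sum>\<gamma>\<in>UNIV. 2 * H \<phi> \<psi> k \<gamma> \<alpha> e * jacobian (transition \<psi> \<psi>') (at x) $ j $ k *
            jacobian (transition \<phi>' \<phi>) (at t') $ \<gamma> $ \<beta>) -
         snd (snd (frechet_derivative (transition (induced_chart T M \<phi> \<psi>) (induced_chart T M \<phi>' \<psi>'))
            (at (t, x, z)) (ddt \<alpha>))) $ j $ \<beta>)"
    if charts: "\<phi> \<in> charts T" "\<psi> \<in> charts M" "\<phi>' \<in> charts T" "\<psi>' \<in> charts M"
      and dom: "e \<in> dom_of (induced_chart T M \<phi> \<psi>)" "e \<in> dom_of (induced_chart T M \<phi>' \<psi>')"
    for \<phi> \<psi> \<phi>' \<psi>' e
  proof -
    obtain t x z t' x' z' where coords: "coord (induced_chart T M \<phi> \<psi>) e = (t, x, z)"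
        "coord (induced_chart T M \<phi>' \<psi>') e = (t', x', z')"
      by (metis prod.exhaust)
    obtain D where D:
      "(transition (induced_chart T M \<phi> \<psi>) (induced_chart T M \<phi>' \<psi>') has_derivative D) (at (t, x, z))"
      "\<And>u. fst (D u) = jacobian (transition \<phi> \<phi>') (at t) *v fst u"
      "\<And>u. fst (snd (D u)) = jacobian (transition \<psi> \<psi>') (at x) *v fst (snd u)"
      "\<And>w. snd (snd (D (0, 0, w))) = jacobian (transition \<psi> \<psi>') (at x) ** w **
        jacobian (transition \<phi>' \<phi>) (at t')"
      using jet_transition_derivative[OF charts dom coords] by blast
    have frechet: "frechet_derivative (transition (induced_chart T M \<phi> \<psi>) (induced_chart T M \<phi>' \<psi>'))
        (at (t, x, z)) = D"
      by (rule frechet_derivative_at[OF D(1), symmetric])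
    then have Dtrans: "J.Dtrans (induced_chart T M \<phi> \<psi>) (induced_chart T M \<phi>' \<psi>') e = D"
      by (simp add: J.Dtrans_def coords)
    show ?thesis
      unfolding Dtrans coords Let_def prod.case frechet
      by (rule spray_map_intertwines_iff[OF has_derivative_linear[OF D(1)] D(2-4)])
  qed
  have "smooth_family T M (\<lambda>\<phi> \<psi> j \<beta> \<alpha> e. 2 * H \<phi> \<psi> j \<beta> \<alpha> e)"
    by (rule smooth_family_scale[OF smooth_T smooth_M assms])
  \<comment> \<open>the smoothness clause of the definition is discharged, which leaves the pointwise law\<close>
  note connection = temporal_nonlinear_connection_def[unfolded Let_def, of T M
      "\<lambda>\<phi> \<psi> j \<beta> \<alpha> e. 2 * H \<phi> \<psi> j \<beta> \<alpha> e", simplified this simp_thms]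
  show ?thesis
    unfolding connection spray_compatible_def Let_def
    by (intro ball_cong refl pointwise[symmetric, unfolded Let_def]) auto
qed

lemma temporal_spray_with_iff:
  "temporal_spray_with T M K H \<longleftrightarrow>
    tensor_field_1_1 (jet_atlas T M) K \<and> smooth_family T M H \<and>
    (\<forall>\<phi>\<in>charts T. \<forall>\<psi>\<in>charts M. \<forall>e\<in>dom_of (induced_chart T M \<phi> \<psi>).
       \<forall>v\<in>tangent_space (jet_atlas T M) e.
         K e v (induced_chart T M \<phi> \<psi>) =
           spray_map (\<lambda>j \<beta> \<alpha>. H \<phi> \<psi> j \<beta> \<alpha> e) (v (induced_chart T M \<phi> \<psi>)))"
  unfolding temporal_spray_with_def Let_def spray_map_expansion by (rule refl)

text \<open>Every \<open>u\<close> is the component vector of some tangent vector \<open>v\<close>, and the components of the tangent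
  vector \<open>K e v\<close> in two charts are related by \<open>D\<close>.\<close>

lemma temporal_spray_with_imp_compatible:
  assumes "temporal_spray_with T M K H"
  shows "spray_compatible H"
  unfolding spray_compatible_def Let_def
proof (intro ballI allI)
  fix \<phi> \<psi> \<phi>' \<psi>' e u
  let ?c = "induced_chart T M \<phi> \<psi>" and ?c' = "induced_chart T M \<phi>' \<psi>'"
  assume charts: "\<phi> \<in> charts T" "\<psi> \<in> charts M" "\<phi>' \<in> charts T" "\<psi>' \<in> charts M"
    and "e \<in> dom_of ?c \<inter> dom_of ?c'"
  then have dom: "e \<in> dom_of ?c" "e \<in> dom_of ?c'" by auto
  note atlas = induced_chart_in_jet_atlas[OF charts(1,2)] induced_chart_in_jet_atlas[OF charts(3,4)]
  define v where "v = coord_vector (jet_atlas T M) ?c u e"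
  have v: "v \<in> tangent_space (jet_atlas T M) e" "v ?c = u" "v ?c' = J.Dtrans ?c ?c' e u"
    using atlas dom
    by (simp_all add: v_def J.coord_vector_in_tangent_space J.coord_vector_self J.coord_vector_eq)
  have "e \<in> (\<Union>c\<in>jet_atlas T M. dom_of c)"
    using atlas dom by blast
  then have "K e v \<in> tangent_space (jet_atlas T M) e"
    using assms v(1) unfolding temporal_spray_with_iff tensor_field_1_1_def by blast
  then have "J.Dtrans ?c ?c' e (K e v ?c) = K e v ?c'"
    using atlas dom by (intro J.Dtrans_tangent)
  moreover have "K e v ?c = spray_map (\<lambda>j \<beta> \<alpha>. H \<phi> \<psi> j \<beta> \<alpha> e) (v ?c)"
    "K e v ?c' = spray_map (\<lambda>j \<beta> \<alpha>. H \<phi>' \<psi>' j \<beta> \<alpha> e) (v ?c')"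
    using assms charts dom v(1) unfolding temporal_spray_with_iff by blast+
  ultimately show "spray_map (\<lambda>j \<beta> \<alpha>. H \<phi>' \<psi>' j \<beta> \<alpha> e) (J.Dtrans ?c ?c' e u) =
      J.Dtrans ?c ?c' e (spray_map (\<lambda>j \<beta> \<alpha>. H \<phi> \<psi> j \<beta> \<alpha> e) u)"
    by (simp only: v(2,3))
qed

lemma smooth_in_chart_spray_map:
  assumes "\<phi> \<in> charts T" "\<psi> \<in> charts M" and "smooth_family T M H"
  shows "smooth_in_chart (induced_chart T M \<phi> \<psi>) (\<lambda>e. spray_map (\<lambda>j \<beta> \<alpha>. H \<phi> \<psi> j \<beta> \<alpha> e) u)"
proof -
  let ?c = "induced_chart T M \<phi> \<psi>"
  let ?S = "coord ?c ` dom_of ?c"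
  have S: "open ?S"
    using assms by (intro J.open_image induced_chart_in_jet_atlas)
  have H: "smooth_on ?S (\<lambda>p. H \<phi> \<psi> j \<beta> \<alpha> (param ?c p))" for j \<beta> \<alpha>
    using assms by (auto simp: smooth_family_def smooth_in_chart_def comp_def)
  have lin: "bounded_linear (\<lambda>r::real. (r * (fst u $ \<alpha>)) *\<^sub>R ddz j \<beta>)" for j \<beta> \<alpha>
    by (intro bounded_linear_scaleR_const bounded_linear_mult_const bounded_linear_ident)
  have neg2: "bounded_linear (\<lambda>w. (-2) *\<^sub>R w :: ('p, 'n) jet_coords)"
    by (rule bounded_linear_scaleR_right)
  have summand: "smooth_on ?S (\<lambda>p. (H \<phi> \<psi> j \<beta> \<alpha> (param ?c p) * (fst u $ \<alpha>)) *\<^sub>R ddz j \<beta>)" for j \<beta> \<alpha>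
    by (rule smooth_on_linear_compose[OF S lin H])
  have "smooth_on ?S (\<lambda>p. \<Sum>j\<in>UNIV. \<Sum>\<beta>\<in>UNIV. \<Sum>\<alpha>\<in>UNIV.
        (H \<phi> \<psi> j \<beta> \<alpha> (param ?c p) * (fst u $ \<alpha>)) *\<^sub>R ddz j \<beta>)"
    by (rule smooth_on_sum[OF S], rule smooth_on_sum[OF S], rule smooth_on_sum[OF S], rule summand)
  from smooth_on_add[OF S smooth_on_const[of _ "\<Sum>\<alpha>\<in>UNIV. (fst u $ \<alpha>) *\<^sub>R ddt \<alpha>"]
      smooth_on_linear_compose[OF S neg2 this]]
  show ?thesis
    unfolding smooth_in_chart_def comp_def spray_map_expansion[symmetric]
    by (simp only: diff_conv_add_uminus scaleR_minus_left)
qed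

text \<open>The endomorphism at a jet \<open>e\<close> is built from its expression in one reference chart \<open>c0 e\<close> around
  \<open>e\<close>; compatibility makes its expression in every other chart the right one. The pair
  \<open>(\<phi>, \<psi>)\<close> is chosen along with the chart, since different pairs may induce the same chart. The choice depends on \<open>e\<close> without any regularity, but smoothness is checked
  in an arbitrary fixed chart, where the choice has disappeared.\<close>

lemma compatible_imp_temporal_spray_components:
  assumes H: "smooth_family T M H" and compat: "spray_compatible H"
  shows "temporal_spray_components T M H"
proof -
  let ?A = "jet_atlas T M"
  define good where "good e q \<longleftrightarrow> fst q \<in> charts T \<and> snd q \<in> charts M \<and>
    e \<in> dom_of (induced_chart T M (fst q) (snd q))" for e q
  define ref where "ref e = (SOME q. good e q)" for e
  define c0 where "c0 e = induced_chart T M (fst (ref e)) (snd (ref e))" for e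
  define S0 where "S0 e = spray_map (\<lambda>j \<beta> \<alpha>. H (fst (ref e)) (snd (ref e)) j \<beta> \<alpha> e)" for e
  define K where "K e v = coord_vector ?A (c0 e) (S0 e (v (c0 e))) e" for e v
  have ref: "good e (ref e)" if e: "e \<in> dom_of c" and c: "c \<in> ?A" for e c
  proof -
    obtain \<phi> \<psi> where "\<phi> \<in> charts T" "\<psi> \<in> charts M" "c = induced_chart T M \<phi> \<psi>"
      using c by (auto simp: jet_atlas_def)
    then have "good e (\<phi>, \<psi>)"
      using e by (simp add: good_def)
    then show ?thesis
      unfolding ref_def by (rule someI)
  qed
  have c0: "c0 e \<in> ?A" "e \<in> dom_of (c0 e)" if "e \<in> dom_of c" "c \<in> ?A" for e c
    using ref[OF that] by (auto simp: good_def c0_def induced_chart_in_jet_atlas)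
  have K: "K e v (induced_chart T M \<phi> \<psi>) =
      spray_map (\<lambda>j \<beta> \<alpha>. H \<phi> \<psi> j \<beta> \<alpha> e) (v (induced_chart T M \<phi> \<psi>))"
    if charts: "\<phi> \<in> charts T" "\<psi> \<in> charts M" and dom: "e \<in> dom_of (induced_chart T M \<phi> \<psi>)"
      and v: "v \<in> tangent_space ?A e" for \<phi> \<psi> e v
  proof -
    let ?c = "induced_chart T M \<phi> \<psi>"
    have c: "?c \<in> ?A"
      using charts by (rule induced_chart_in_jet_atlas)
    have "K e v ?c = J.Dtrans (c0 e) ?c e (S0 e (v (c0 e)))"
      using c dom by (simp add: K_def J.coord_vector_eq)
    also have "\<dots> = spray_map (\<lambda>j \<beta> \<alpha>. H \<phi> \<psi> j \<beta> \<alpha> e) (J.Dtrans (c0 e) ?c e (v (c0 e)))"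
      using ref[OF dom c] unfolding c0_def S0_def good_def
      by (intro spray_compatibleD[OF compat] charts dom) auto
    also have "J.Dtrans (c0 e) ?c e (v (c0 e)) = v ?c"
      using v c c0[OF dom c] dom by (intro J.Dtrans_tangent)
    finally show ?thesis .
  qed
  have tensor: "tensor_field_1_1 ?A K"
    unfolding tensor_field_1_1_def
  proof (intro conjI ballI allI)
    fix e v assume "e \<in> (\<Union>c\<in>?A. dom_of c)"
    then obtain c where c: "e \<in> dom_of c" "c \<in> ?A" by blast
    show "K e v \<in> tangent_space ?A e"
      unfolding K_def using c0[OF c] by (rule J.coord_vector_in_tangent_space)
  next
    fix e u v and a b :: real assume "e \<in> (\<Union>c\<in>?A. dom_of c)"
    then obtain c where c: "e \<in> dom_of c" "c \<in> ?A" by blast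
    have "linear (S0 e)"
      unfolding S0_def by (rule linear_spray_map)
    then show "K e (\<lambda>c. a *\<^sub>R u c + b *\<^sub>R v c) = (\<lambda>c. a *\<^sub>R K e u c + b *\<^sub>R K e v c)"
      unfolding K_def
      using J.coord_vector_linear[OF c0[OF c]] by (simp add: linear_add linear_scale)
  next
    fix c and b :: "('p, 'n) jet_coords" assume c: "c \<in> ?A"
    then obtain \<phi> \<psi> where charts: "\<phi> \<in> charts T" "\<psi> \<in> charts M" and c_eq: "c = induced_chart T M \<phi> \<psi>"
      by (auto simp: jet_atlas_def)
    have "K e (coord_vector ?A c b e) c = spray_map (\<lambda>j \<beta> \<alpha>. H \<phi> \<psi> j \<beta> \<alpha> e) b"
      if dom: "e \<in> dom_of c" for e
      using K[OF charts dom[unfolded c_eq] J.coord_vector_in_tangent_space[OF c dom], folded c_eq]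
      by (simp add: J.coord_vector_self[OF c dom])
    then have "spray_map (\<lambda>j \<beta> \<alpha>. H \<phi> \<psi> j \<beta> \<alpha> (param c p)) b =
        K (param c p) (coord_vector ?A c b (param c p)) c" if "p \<in> coord c ` dom_of c" for p
      using that J.param_coord[OF c] by auto
    then show "smooth_in_chart c (\<lambda>e. K e (coord_vector ?A c b e) c)"
      using smooth_in_chart_spray_map[OF charts H, of b, folded c_eq]
      unfolding smooth_in_chart_def comp_def by (rule smooth_on_cong[OF J.open_image[OF c]])
  qed
  have "temporal_spray_with T M K H"
    using tensor H K by (simp add: temporal_spray_with_iff)
  then show ?thesis
    unfolding temporal_spray_components_def by (rule exI[of _ K])
qed

lemma temporal_spray_iff_connection:
  "temporal_spray_components T M H \<longleftrightarrow>
    temporal_nonlinear_connection T M (\<lambda>\<phi> \<psi> j \<beta> \<alpha> e. 2 * H \<phi> \<psi> j \<beta> \<alpha> e)"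
proof
  assume "temporal_spray_components T M H"
  then obtain K where K: "temporal_spray_with T M K H"
    by (auto simp: temporal_spray_components_def)
  then have "smooth_family T M H"
    by (simp add: temporal_spray_with_def)
  then show "temporal_nonlinear_connection T M (\<lambda>\<phi> \<psi> j \<beta> \<alpha> e. 2 * H \<phi> \<psi> j \<beta> \<alpha> e)"
    using temporal_spray_with_imp_compatible[OF K] temporal_nonlinear_connection_double_iff by blast
next
  assume N: "temporal_nonlinear_connection T M (\<lambda>\<phi> \<psi> j \<beta> \<alpha> e. 2 * H \<phi> \<psi> j \<beta> \<alpha> e)"
  then have "smooth_family T M (\<lambda>\<phi> \<psi> j \<beta> \<alpha> e. 2 * H \<phi> \<psi> j \<beta> \<alpha> e)"
    unfolding temporal_nonlinear_connection_def by blast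
  from smooth_family_scale[OF smooth_T smooth_M this, of "1/2"]
  have H: "smooth_family T M H" by simp
  then show "temporal_spray_components T M H"
    using N temporal_nonlinear_connection_double_iff[OF H] compatible_imp_temporal_spray_components[OF H]
    by simp
qed

end

theorem theorem3p2:
  fixes T :: "('t, real^'p) manifold" and M :: "('m, real^'n) manifold"
  assumes "smooth_manifold T" and "smooth_manifold M"
  shows "(\<forall>N. temporal_nonlinear_connection T M N \<longrightarrow>
            temporal_spray_components T M (\<lambda>\<phi> \<psi> i \<alpha> \<beta> e. 1/2 * N \<phi> \<psi> i \<alpha> \<beta> e)) \<and>
         (\<forall>H. temporal_spray_components T M H \<longrightarrow>
            temporal_nonlinear_connection T M (\<lambda>\<phi> \<psi> i \<alpha> \<beta> e. 2 * H \<phi> \<psi> i \<alpha> \<beta> e))"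
proof -
  interpret two_manifolds T M
    using assms by unfold_locales
  have "temporal_spray_components T M (\<lambda>\<phi> \<psi> i \<alpha> \<beta> e. 1/2 * N \<phi> \<psi> i \<alpha> \<beta> e) \<longleftrightarrow>
      temporal_nonlinear_connection T M N" for N
    using temporal_spray_iff_connection[of "\<lambda>\<phi> \<psi> i \<alpha> \<beta> e. 1/2 * N \<phi> \<psi> i \<alpha> \<beta> e"] by simp
  then show ?thesis
    using temporal_spray_iff_connection by blast
qed

end
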